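(* For all integers $n,k\ge1$, the Banach space $\mathscr Z_{n+k}$ is not isomorphic to $\mathscr Z_n\oplus\mathscr Z_k$.
   Context: Let $\mathbb S=\{z\in\mathbb C:0<\Re z<1\}$ and let $\mathscr Z=\mathscr C(\ell_\infty,\ell_1)$ be the Calderón space of the couple $(\ell_\infty,\ell_1)$ of complex sequence spaces: the analytic functions $f:\mathbb S\to\ell_\infty$ that extend to continuous bounded functions $\overline{\mathbb S}\to\ell_\infty$, with $t\mapsto f(1+it)\in\ell_1$ continuous and bounded, normed by $\|f\|_{\mathscr Z}=\sup\{\|f(it)\|_\infty,\|f(1+it)\|_1:t\in\mathbb R\}<\infty$. For $n\ge1$, $$\mathscr Z_n=\left\{\left(\tfrac{f^{(n-1)}(1/2)}{(n-1)!},\dots,f'(1/2),f(1/2)\right): f\in\mathscr Z\right\}$$ with the quotient norm (infimum of $\|f\|_{\mathscr Z}$ over representing $f$). *)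

theory Defs
  imports "HOL-Analysis.Analysis"
begin

section \<open>The complex sequence spaces\<close>

text \<open>Since \<open>nat\<close> is discrete, \<open>nat \<Rightarrow>\<^sub>C complex\<close> consists of all bounded complex
  sequences, and its library norm is the supremum norm. The library only provides its
  real scalar multiplication.\<close>

type_synonym ell_infty = "nat \<Rightarrow>\<^sub>C complex"

definition cscale :: "complex \<Rightarrow> ell_infty \<Rightarrow> ell_infty"
  where "cscale c x = Bcontfun (\<lambda>i. c * apply_bcontfun x i)"

lemma apply_cscale [simp]: "apply_bcontfun (cscale c x) i = c * apply_bcontfun x i"
proof -
  have "bounded (range (\<lambda>i. c * apply_bcontfun x i))"
    using bounded_linear_image[OF bounded_apply_bcontfun[of x] bounded_linear_mult_right[of c]]
    by (simp add: image_image)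
  then have "(\<lambda>i. c * apply_bcontfun x i) \<in> bcontfun"
    by (auto simp: bcontfun_def)
  then show ?thesis
    by (simp add: cscale_def Bcontfun_inverse)
qed

definition ell_1 :: "ell_infty set"
  where "ell_1 = {x. summable (\<lambda>i. norm (apply_bcontfun x i))}"

definition norm_1 :: "ell_infty \<Rightarrow> real"
  where "norm_1 x = (\<Sum>i. norm (apply_bcontfun x i))"


section \<open>Complex derivatives of functions with values in the bounded sequences\<close>

definition has_cderiv :: "(complex \<Rightarrow> ell_infty) \<Rightarrow> ell_infty \<Rightarrow> complex \<Rightarrow> bool"
  where "has_cderiv f D z \<longleftrightarrow> (f has_derivative (\<lambda>h. cscale h D)) (at z)"

definition cderiv :: "(complex \<Rightarrow> ell_infty) \<Rightarrow> complex \<Rightarrow> ell_infty"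
  where "cderiv f z = (THE D. has_cderiv f D z)"

lemma cscale_1 [simp]: "cscale 1 x = x"
  by (rule bcontfun_eqI) simp

lemma cderiv_eq: "has_cderiv f D z \<Longrightarrow> cderiv f z = D"
  unfolding cderiv_def has_cderiv_def
  by (rule the_equality, assumption) (metis has_derivative_unique cscale_1)


section \<open>The Calderon space of the couple\<close>

definition strip :: "complex set"
  where "strip = {z. 0 < Re z \<and> Re z < 1}"

text \<open>The continuous extension of a function to the closed strip is unique, so we take functions
  that are already given on the closed strip. Values elsewhere are irrelevant: neither the
  norm nor the derivatives at interior points depend on them.\<close>

definition calderon :: "(complex \<Rightarrow> ell_infty) set"
  where "calderon = {f.
    (\<forall>z\<in>strip. \<exists>D. has_cderiv f D z) \<and>
    continuous_on (closure strip) f \<and>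
    bounded (f ` closure strip) \<and>
    (\<forall>t::real. f (1 + \<i> * t) \<in> ell_1) \<and>
    (\<forall>t::real. ((\<lambda>s::real. norm_1 (f (1 + \<i> * s) - f (1 + \<i> * t))) \<longlongrightarrow> 0) (at t)) \<and>
    (\<exists>B. \<forall>t::real. norm_1 (f (1 + \<i> * t)) \<le> B)}"

definition calderon_norm :: "(complex \<Rightarrow> ell_infty) \<Rightarrow> real"
  where "calderon_norm f =
    Sup (range (\<lambda>t::real. norm (f (\<i> * t))) \<union> range (\<lambda>t::real. norm_1 (f (1 + \<i> * t))))"


section \<open>Complex normed spaces, direct sums and isomorphisms\<close>

record 'a cnormed =
  carr :: "'a set"
  add :: "'a \<Rightarrow> 'a \<Rightarrow> 'a"
  scale :: "complex \<Rightarrow> 'a \<Rightarrow> 'a"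
  nrm :: "'a \<Rightarrow> real"

text \<open>The sum norm represents the usual equivalence class of norms on a direct sum; isomorphism
  does not depend on the representative.\<close>

definition direct_sum :: "'a cnormed \<Rightarrow> 'b cnormed \<Rightarrow> ('a \<times> 'b) cnormed"
  where "direct_sum X Y = \<lparr>
    carr = carr X \<times> carr Y,
    add = (\<lambda>p q. (add X (fst p) (fst q), add Y (snd p) (snd q))),
    scale = (\<lambda>c p. (scale X c (fst p), scale Y c (snd p))),
    nrm = (\<lambda>p. nrm X (fst p) + nrm Y (snd p))\<rparr>"

definition isomorphic :: "'a cnormed \<Rightarrow> 'b cnormed \<Rightarrow> bool"
  where "isomorphic X Y \<longleftrightarrow> (\<exists>T.
    bij_betw T (carr X) (carr Y) \<and>
    (\<forall>x\<in>carr X. \<forall>y\<in>carr X. T (add X x y) = add Y (T x) (T y)) \<and>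
    (\<forall>c. \<forall>x\<in>carr X. T (scale X c x) = scale Y c (T x)) \<and>
    (\<exists>C. \<forall>x\<in>carr X. nrm Y (T x) \<le> C * nrm X x) \<and>
    (\<exists>C. \<forall>x\<in>carr X. nrm X x \<le> C * nrm Y (T x)))"


section \<open>The spaces of Taylor coefficients\<close>

text \<open>An \<open>n\<close>-tuple is a function on \<open>nat\<close> that vanishes from \<open>n\<close> on. Entry \<open>i\<close> is the Taylor
  coefficient of order \<open>n - 1 - i\<close>, so the orders run from \<open>n - 1\<close> down to \<open>0\<close>.\<close>

definition taylor_tuple :: "nat \<Rightarrow> (complex \<Rightarrow> ell_infty) \<Rightarrow> nat \<Rightarrow> ell_infty"
  where "taylor_tuple n f = (\<lambda>i.
    if i < n then (cderiv ^^ (n - 1 - i)) f (1/2) /\<^sub>R fact (n - 1 - i) else 0)"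

definition Z :: "nat \<Rightarrow> (nat \<Rightarrow> ell_infty) cnormed"
  where "Z n = \<lparr>
    carr = taylor_tuple n ` calderon,
    add = (\<lambda>x y i. x i + y i),
    scale = (\<lambda>c x i. cscale c (x i)),
    nrm = (\<lambda>x. Inf {calderon_norm f | f. f \<in> calderon \<and> taylor_tuple n f = x})\<rparr>"

end

theory Submission
  imports Defs "HOL-Complex_Analysis.Complex_Analysis" "HOL-Real_Asymp.Real_Asymp"
begin

text \<open>
  Let \<open>N = n + k\<close> and let \<open>e\<^sub>j\<close> be the unit sequence in the last entry of \<open>Z N\<close>. An isomorphism
  is excluded by comparing the norm of a sum of \<open>m\<close> differences of vectors \<open>e\<^sub>j\<close> with the norm of
  its image, whose components \<open>u\<^sub>j\<close> and \<open>v\<^sub>j\<close> lie in \<open>Z n\<close> and \<open>Z k\<close>.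

  In \<open>Z N\<close>, a sum of \<open>M\<close> signed unit vectors has norm at least a multiple of
  \<open>sqrt M (ln M)^(N - 1)\<close>: if \<open>f\<close> represents it, pair \<open>f z\<close> with the signs and multiply by
  \<open>M^(z - 1)\<close>. The result is bounded by \<open>\<parallel>f\<parallel>\<close> on the strip, while its Taylor coefficient of
  order \<open>N - 1\<close> at \<open>1/2\<close> is \<open>sqrt M (ln M)^(N - 1) / (N - 1)!\<close>.

  In \<open>Z n\<close>, the \<open>u\<^sub>j\<close> are bounded. After passing to a subsequence with convergent coordinates, suitable
  differences of the \<open>u\<^sub>j\<close> are, up to small perturbations, disjointly supported (gliding hump). If
  \<open>F\<close> is the sum of \<open>m\<close> disjointly supported functions of norm at most \<open>K\<close>, then
  \<open>m^(1/2 - z) F\<close> has norm at most \<open>sqrt m K\<close>, and only the jet of \<open>m^(z - 1/2)\<close> of order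
  \<open>n\<close> is needed to undo this multiplication, which costs a factor \<open>(1 + ln m)^(n - 1)\<close>. As
  \<open>max n k < N\<close>, an isomorphism would contradict the lower bound.
\<close>

section \<open>Functions on the strip\<close>

lemma open_strip: "open strip"
proof -
  have eq: "strip = {z. 0 < Re z} \<inter> {z. Re z < 1}"
    by (auto simp: strip_def)
  show ?thesis
    unfolding eq by (intro open_Int open_halfspace_Re_gt open_halfspace_Re_lt)
qed

lemma closure_strip: "closure strip = {z. 0 \<le> Re z \<and> Re z \<le> 1}"
proof (intro equalityI subsetI)
  fix z assume "z \<in> closure strip"
  moreover have "closed ({z. Re z \<ge> 0} \<inter> {z. Re z \<le> 1})"
    by (intro closed_Int closed_halfspace_Re_ge closed_halfspace_Re_le)
  moreover have "strip \<subseteq> {z. Re z \<ge> 0} \<inter> {z. Re z \<le> 1}"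
    by (auto simp: strip_def)
  ultimately show "z \<in> {z. 0 \<le> Re z \<and> Re z \<le> 1}"
    using closure_minimal by blast
next
  fix z :: complex assume z: "z \<in> {z. 0 \<le> Re z \<and> Re z \<le> 1}"
  \<comment> \<open>A boundary point is approached along the segment towards \<open>1/2\<close>,
    whose points with parameter in \<open>(0, 1)\<close> lie in the strip.\<close>
  have "((\<lambda>s::real. z + s *\<^sub>R (1/2 - z)) \<longlongrightarrow> z + 0 *\<^sub>R (1/2 - z)) (at_right 0)"
    by (intro tendsto_intros)
  then have lim: "((\<lambda>s::real. z + s *\<^sub>R (1/2 - z)) \<longlongrightarrow> z) (at_right 0)"
    by simp
  have "eventually (\<lambda>s::real. s \<in> {0<..<1}) (at_right 0)"
    by (rule eventually_at_right_real) simp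
  then have "eventually (\<lambda>s::real. z + s *\<^sub>R (1/2 - z) \<in> closure strip) (at_right 0)"
  proof eventually_elim
    case (elim s)
    have "Re (z + s *\<^sub>R (1/2 - z)) = (1 - s) * Re z + s / 2"
      by (simp add: algebra_simps)
    moreover have s: "0 < s" "s < 1" and r: "0 \<le> Re z" "Re z \<le> 1"
      using elim z by auto
    moreover have "0 \<le> (1 - s) * Re z" "(1 - s) * Re z \<le> 1 - s"
      using s r by (simp_all add: mult_left_le)
    ultimately have "0 < Re (z + s *\<^sub>R (1/2 - z))" "Re (z + s *\<^sub>R (1/2 - z)) < 1"
      by linarith+
    then have "z + s *\<^sub>R (1/2 - z) \<in> strip"
      by (simp only: strip_def mem_Collect_eq)
    then show ?case
      using closure_subset by blast
  qed
  then show "z \<in> closure strip"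
    by (rule Lim_in_closed_set[OF closed_closure _ trivial_limit_at_right_real lim])
qed

lemma strip_half [simp]: "1/2 \<in> strip"
  by (simp add: strip_def)

lemma strip_subset_closure: "z \<in> strip \<Longrightarrow> z \<in> closure strip"
  using closure_subset by blast

lemma edges_in_closure_strip [simp]:
  "\<i> * complex_of_real t \<in> closure strip" "1 + \<i> * complex_of_real t \<in> closure strip"
  by (simp_all add: closure_strip)

section \<open>Derivatives of sequence-valued functions through their coordinates\<close>

lemma apply_Bcontfun:
  fixes g :: "nat \<Rightarrow> complex"
  assumes "\<And>j. norm (g j) \<le> B"
  shows "apply_bcontfun (Bcontfun g) = g"
proof -
  have "g \<in> bcontfun"
    using assms by (intro bcontfun_normI[of _ B]) auto
  then show ?thesis
    by (simp add: Bcontfun_inverse)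
qed

lemma bounded_linear_coord: "bounded_linear (\<lambda>x :: ell_infty. apply_bcontfun x j)"
  by (rule bounded_linear_intro[of _ 1]) (auto simp: norm_bounded)

lemma has_cderiv_coord:
  assumes "has_cderiv f D z"
  shows "((\<lambda>w. apply_bcontfun (f w) j) has_field_derivative apply_bcontfun D j) (at z)"
  using bounded_linear.has_derivative[OF bounded_linear_coord assms[unfolded has_cderiv_def], of j]
  by (simp add: has_field_derivative_def mult.commute[of _ "apply_bcontfun D j"])

text \<open>Cauchy's estimates make the coordinatewise Taylor remainders uniform over the coordinates.\<close>

lemma has_cderiv_coordwise:
  fixes f :: "complex \<Rightarrow> ell_infty"
  assumes "r > 0"
    and hol: "\<And>j. (\<lambda>w. apply_bcontfun (f w) j) holomorphic_on ball z r"
    and bd: "\<And>j w. w \<in> ball z r \<Longrightarrow> norm (apply_bcontfun (f w) j) \<le> B"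
  obtains D where "has_cderiv f D z"
    and "\<And>j. apply_bcontfun D j = deriv (\<lambda>w. apply_bcontfun (f w) j) z"
proof -
  define F where "F = (\<lambda>j w. apply_bcontfun (f w) j)"
  \<comment> \<open>The closed disc of radius \<open>r / 4\<close> about a point of
    \<open>ball z (r / 2)\<close> stays within \<open>ball z r\<close>, and the resulting bound does
    not involve \<open>j\<close>.\<close>
  have est: "norm ((deriv ^^ l) (F j) w) \<le> fact l * B / (r / 4) ^ l" if "w \<in> ball z (r / 2)" for l j w
  proof (rule Cauchy_inequality)
    have sub: "cball w (r / 4) \<subseteq> ball z r"
    proof
      fix u assume "u \<in> cball w (r / 4)"
      then show "u \<in> ball z r"
        using that \<open>r > 0\<close> dist_triangle[of z u w] by (simp add: dist_commute)
    qed
    show "F j holomorphic_on ball w (r / 4)"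
      using hol[of j] sub ball_subset_cball[of w "r/4"] unfolding F_def by (meson holomorphic_on_subset subset_trans)
    show "continuous_on (cball w (r / 4)) (F j)"
      using hol[of j] sub unfolding F_def by (meson holomorphic_on_subset holomorphic_on_imp_continuous_on)
    show "0 < r / 4" using \<open>r > 0\<close> by simp
    show "cmod (F j x) \<le> B" if "cmod (w - x) = r / 4" for x
      using bd[of x j] sub that by (auto simp: F_def dist_norm)
  qed
  have z: "z \<in> ball z (r / 2)" using \<open>r > 0\<close> by simp
  define D where "D = Bcontfun (\<lambda>j. deriv (F j) z)"
  have D: "apply_bcontfun D = (\<lambda>j. deriv (F j) z)"
    unfolding D_def using est[OF z, of 1] by (intro apply_Bcontfun) auto
  define C where "C = fact 2 * B / (r / 4)\<^sup>2"
  \<comment> \<open>The first-order Taylor remainder of every coordinate is controlled by the second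
    derivative with the common constant \<open>C\<close>; hence it is a remainder in the supremum
    norm.\<close>
  have rem: "norm (f y - f z - cscale (y - z) D) \<le> C * norm (y - z) ^ 2" if y: "y \<in> ball z (r / 2)" for y
  proof (rule norm_bound)
    fix j
    have "norm ((deriv ^^ 0) (F j) y - (\<Sum>i\<le>1. (deriv ^^ i) (F j) z * (y - z) ^ i / fact i))
        \<le> C * norm (y - z) ^ (Suc 1) / fact 1"
    proof (rule complex_Taylor[where S = "ball z (r / 2)"])
      show "((deriv ^^ i) (F j) has_field_derivative (deriv ^^ Suc i) (F j) x) (at x within ball z (r / 2))"
        if "x \<in> ball z (r / 2)" for i x
      proof -
        have "F j holomorphic_on ball z (r / 2)"
          using hol[of j] \<open>r > 0\<close> unfolding F_def by (auto intro: holomorphic_on_subset)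
        then show ?thesis
          using that has_field_derivative_higher_deriv has_field_derivative_at_within by blast
      qed
      show "norm ((deriv ^^ Suc 1) (F j) x) \<le> C" if "x \<in> ball z (r / 2)" for x
        using est[OF that, of 2 j] by (simp add: C_def numeral_2_eq_2)
    qed (use y z in auto)
    then show "norm (apply_bcontfun (f y - f z - cscale (y - z) D) j) \<le> C * norm (y - z) ^ 2"
      by (simp add: F_def D power2_eq_square algebra_simps)
  qed
  have bl: "bounded_linear (\<lambda>h. cscale h D)"
  proof (rule bounded_linear_intro[of _ "norm D"])
    show "norm (cscale h D) \<le> norm h * norm D" for h
      by (rule norm_bound) (auto simp: norm_mult intro!: mult_left_mono norm_bounded)
  qed (auto intro!: bcontfun_eqI simp: algebra_simps)
  have "has_cderiv f D z"
    unfolding has_cderiv_def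
  proof (rule has_derivativeI_sandwich[where e = "r / 2" and H = "\<lambda>y. \<bar>C\<bar> * norm (y - z)"])
    show "((\<lambda>y. \<bar>C\<bar> * norm (y - z)) \<longlongrightarrow> 0) (at z)"
      by (rule tendsto_eq_intros refl | simp)+
    fix y assume "y \<noteq> z" "dist y z < r / 2"
    then have "norm (f y - f z - cscale (y - z) D) \<le> C * norm (y - z) ^ 2"
      using rem[of y] by (simp add: dist_commute)
    also have "\<dots> \<le> \<bar>C\<bar> * norm (y - z) ^ 2"
      by (intro mult_right_mono) auto
    finally show "norm (f y - f z - cscale (y - z) D) / norm (y - z) \<le> \<bar>C\<bar> * norm (y - z)"
      using \<open>y \<noteq> z\<close> by (simp add: divide_le_eq power2_eq_square mult.assoc)
  qed (use \<open>r > 0\<close> bl in auto)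
  then show thesis
    using that D by (auto simp: F_def)
qed

text \<open>Iterated derivatives in the supremum norm reduce to scalar ones by induction: Cauchy's
  inequality bounds the \<open>l\<close>-th coordinate derivatives near \<open>z\<close> uniformly
  in \<open>j\<close>, so \<open>has_cderiv_coordwise\<close> applies again to
  \<open>(cderiv ^^ l) f\<close>.\<close>

lemma higher_cderiv_coord:
  fixes f :: "complex \<Rightarrow> ell_infty"
  assumes hol: "\<And>j. (\<lambda>w. apply_bcontfun (f w) j) holomorphic_on strip"
    and bd: "\<And>j w. w \<in> strip \<Longrightarrow> norm (apply_bcontfun (f w) j) \<le> B"
    and "z \<in> strip"
  shows "apply_bcontfun ((cderiv ^^ l) f z) j = (deriv ^^ l) (\<lambda>w. apply_bcontfun (f w) j) z"
  using \<open>z \<in> strip\<close>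
proof (induction l arbitrary: z j)
  case 0
  then show ?case by simp
next
  case (Suc l)
  let ?g = "(cderiv ^^ l) f"
  obtain r where r: "r > 0" "ball z r \<subseteq> strip"
    using Suc.prems open_strip open_contains_ball by blast
  have hol': "(\<lambda>w. apply_bcontfun (?g w) j) holomorphic_on strip" for j
    using holomorphic_higher_deriv[OF hol open_strip, of l j]
    by (rule holomorphic_transform) (simp add: Suc.IH)
  have "norm (apply_bcontfun (?g w) j) \<le> fact l * B / (r / 4) ^ l" if w: "w \<in> ball z (r / 2)" for j w
  proof -
    have sub: "cball w (r / 4) \<subseteq> strip"
    proof
      fix u assume "u \<in> cball w (r / 4)"
      then show "u \<in> strip"
        using w r dist_triangle[of z u w] by (intro subsetD[OF r(2)]) (simp add: dist_commute)
    qed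
    have "norm ((deriv ^^ l) (\<lambda>w. apply_bcontfun (f w) j) w) \<le> fact l * B / (r / 4) ^ l"
    proof (rule Cauchy_inequality)
      show "(\<lambda>w. apply_bcontfun (f w) j) holomorphic_on ball w (r / 4)"
        using hol[of j] sub ball_subset_cball[of w "r/4"] by (meson holomorphic_on_subset subset_trans)
      show "continuous_on (cball w (r / 4)) (\<lambda>w. apply_bcontfun (f w) j)"
        using hol[of j] sub by (meson holomorphic_on_subset holomorphic_on_imp_continuous_on)
      show "cmod (apply_bcontfun (f x) j) \<le> B" if "cmod (w - x) = r / 4" for x
        using bd[of x j] sub that by (auto simp: dist_norm)
    qed (use r in simp)
    moreover have "w \<in> strip" using sub r(1) by auto
    ultimately show ?thesis by (simp add: Suc.IH)
  qed
  moreover have "(\<lambda>w. apply_bcontfun (?g w) j) holomorphic_on ball z (r / 2)" for j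
    by (rule holomorphic_on_subset[OF hol']) (use r in auto)
  moreover have "r / 2 > 0" using r by simp
  ultimately obtain D where D: "has_cderiv ?g D z"
      "\<And>j. apply_bcontfun D j = deriv (\<lambda>w. apply_bcontfun (?g w) j) z"
    using has_cderiv_coordwise by metis
  have "apply_bcontfun ((cderiv ^^ Suc l) f z) j = deriv (\<lambda>w. apply_bcontfun (?g w) j) z"
    using cderiv_eq[OF D(1)] D(2) by simp
  also have "\<dots> = deriv ((deriv ^^ l) (\<lambda>w. apply_bcontfun (f w) j)) z"
    using hol' holomorphic_higher_deriv[OF hol open_strip] open_strip Suc
    by (intro complex_derivative_transform_within_open[where s = strip]) auto
  finally show ?case by simp
qed

section \<open>Closure properties of the Calderon space\<close>

lemma norm_cscale_le: "norm (cscale c x) \<le> norm c * norm x"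
  by (rule norm_bound) (auto simp: norm_mult intro!: mult_left_mono norm_bounded)

lemma bounded_bilinear_cscale: "bounded_bilinear cscale"
proof (rule bounded_bilinear.intro)
  show "\<exists>K. \<forall>c x. norm (cscale c x) \<le> norm c * norm x * K"
  proof (intro exI allI)
    show "norm (cscale c x) \<le> norm c * norm x * 1" for c x
      using norm_cscale_le by simp
  qed
qed (auto intro!: bcontfun_eqI simp: algebra_simps)

lemma norm_1_nonneg: "x \<in> ell_1 \<Longrightarrow> 0 \<le> norm_1 x"
  unfolding norm_1_def ell_1_def by (intro suminf_nonneg) auto

lemma norm_1_0 [simp]: "norm_1 0 = 0"
  by (simp add: norm_1_def)

lemma ell_1_0 [simp]: "0 \<in> ell_1"
  by (simp add: ell_1_def)

lemma norm_1_mono: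
  assumes "y \<in> ell_1" "\<And>j. norm (apply_bcontfun x j) \<le> norm (apply_bcontfun y j)"
  shows "x \<in> ell_1" "norm_1 x \<le> norm_1 y"
proof -
  show "x \<in> ell_1"
    using assms unfolding ell_1_def by (auto intro: summable_comparison_test')
  then show "norm_1 x \<le> norm_1 y"
    using assms unfolding ell_1_def norm_1_def by (intro suminf_le) auto
qed

lemma ell_1_add:
  assumes "x \<in> ell_1" "y \<in> ell_1"
  shows "x + y \<in> ell_1" "norm_1 (x + y) \<le> norm_1 x + norm_1 y"
proof -
  have s: "summable (\<lambda>i. norm (apply_bcontfun x i) + norm (apply_bcontfun y i))"
    using assms unfolding ell_1_def by (intro summable_add) auto
  show "x + y \<in> ell_1"
    unfolding ell_1_def mem_Collect_eq
    by (rule summable_comparison_test'[OF s]) (auto intro: norm_triangle_ineq)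
  then show "norm_1 (x + y) \<le> norm_1 x + norm_1 y"
    using assms unfolding ell_1_def norm_1_def
    by (subst suminf_add) (auto intro!: suminf_le s norm_triangle_ineq)
qed

lemma ell_1_cscale:
  assumes "x \<in> ell_1"
  shows "cscale c x \<in> ell_1" "norm_1 (cscale c x) = norm c * norm_1 x"
  using assms unfolding ell_1_def norm_1_def by (auto simp: norm_mult summable_mult suminf_mult)

lemma minus_eq_cscale: "x - y = x + cscale (-1) y"
  by (rule bcontfun_eqI) simp

lemma ell_1_diff:
  assumes "x \<in> ell_1" "y \<in> ell_1"
  shows "x - y \<in> ell_1" "norm_1 (x - y) \<le> norm_1 x + norm_1 y"
  using ell_1_add[OF assms(1) ell_1_cscale(1)[OF assms(2)], of "-1"] ell_1_cscale(2)[OF assms(2)]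
  by (auto simp: minus_eq_cscale[symmetric])

lemma norm_coord_le_norm_1:
  assumes "x \<in> ell_1"
  shows "norm (apply_bcontfun x j) \<le> norm_1 x"
  using sum_le_suminf[of "\<lambda>i. norm (apply_bcontfun x i)" "{j}"] assms
  by (simp add: ell_1_def norm_1_def)

section \<open>Truncations to sets of coordinates, and unit sequences\<close>

definition trunc :: "nat set \<Rightarrow> ell_infty \<Rightarrow> ell_infty"
  where "trunc A x = Bcontfun (\<lambda>j. if j \<in> A then apply_bcontfun x j else 0)"

lemma apply_trunc [simp]: "apply_bcontfun (trunc A x) j = (if j \<in> A then apply_bcontfun x j else 0)"
  unfolding trunc_def by (subst apply_Bcontfun[of _ "norm x"]) (auto simp: norm_bounded)

lemma norm_trunc_le: "norm (trunc A x) \<le> norm x"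
  by (rule norm_bound) (auto simp: norm_bounded)

lemma ell_1_trunc:
  assumes "x \<in> ell_1"
  shows "trunc A x \<in> ell_1" "norm_1 (trunc A x) \<le> norm_1 x"
  using norm_1_mono[OF assms, of "trunc A x"] by auto

lemma bounded_linear_trunc: "bounded_linear (trunc A)"
  by (rule bounded_linear_intro[of _ 1]) (auto intro!: bcontfun_eqI simp: norm_trunc_le)

definition unit_seq :: "nat \<Rightarrow> ell_infty"
  where "unit_seq i = Bcontfun (\<lambda>j. if j = i then 1 else 0)"

lemma apply_unit_seq [simp]: "apply_bcontfun (unit_seq i) j = (if j = i then 1 else 0)"
  unfolding unit_seq_def by (subst apply_Bcontfun[of _ 1]) auto

lemma norm_unit_seq_le: "norm (unit_seq i) \<le> 1"
  by (rule norm_bound) auto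

lemma ell_1_unit_seq: "unit_seq i \<in> ell_1" and norm_1_unit_seq: "norm_1 (unit_seq i) = 1"
proof -
  have "(\<lambda>j. norm (apply_bcontfun (unit_seq i) j)) sums (\<Sum>j\<in>{i}. norm (apply_bcontfun (unit_seq i) j))"
    by (rule sums_finite) auto
  then show "unit_seq i \<in> ell_1" "norm_1 (unit_seq i) = 1"
    by (auto simp: ell_1_def norm_1_def sums_iff)
qed

text \<open>Holomorphic coordinates suffice here: boundedness on the closed strip makes the
  estimates uniform over the coordinates, so \<open>has_cderiv_coordwise\<close> yields the
  vector-valued derivatives that membership requires.\<close>

lemma calderonI:
  assumes hol: "\<And>j. (\<lambda>z. apply_bcontfun (f z) j) holomorphic_on strip"
    and "continuous_on (closure strip) f" "bounded (f ` closure strip)"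
    and "\<And>t::real. f (1 + \<i> * t) \<in> ell_1"
    and "\<And>t::real. ((\<lambda>s::real. norm_1 (f (1 + \<i> * s) - f (1 + \<i> * t))) \<longlongrightarrow> 0) (at t)"
    and "\<And>t::real. norm_1 (f (1 + \<i> * t)) \<le> B"
  shows "f \<in> calderon"
proof -
  obtain M where M: "\<And>z. z \<in> closure strip \<Longrightarrow> norm (f z) \<le> M"
    using assms(3) unfolding bounded_iff by auto
  have "\<exists>D. has_cderiv f D z" if z: "z \<in> strip" for z
  proof -
    obtain r where r: "r > 0" "ball z r \<subseteq> strip"
      using z open_strip open_contains_ball by blast
    have "norm (apply_bcontfun (f w) j) \<le> M" if "w \<in> ball z r" for j w
      using M[of w] that r strip_subset_closure norm_bounded[of "f w" j] by fastforce
    then show ?thesis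
      using has_cderiv_coordwise[OF r(1) holomorphic_on_subset[OF hol r(2)], of M] by metis
  qed
  with assms show ?thesis
    unfolding calderon_def by blast
qed

lemma calderonD:
  assumes "f \<in> calderon"
  shows "(\<lambda>z. apply_bcontfun (f z) j) holomorphic_on strip"
    and "continuous_on (closure strip) f" "bounded (f ` closure strip)"
    and "\<And>t::real. f (1 + \<i> * t) \<in> ell_1"
    and "\<And>t::real. ((\<lambda>s::real. norm_1 (f (1 + \<i> * s) - f (1 + \<i> * t))) \<longlongrightarrow> 0) (at t)"
proof -
  show "(\<lambda>z. apply_bcontfun (f z) j) holomorphic_on strip"
    unfolding holomorphic_on_open[OF open_strip]
  proof
    fix z assume "z \<in> strip"
    then obtain D where "has_cderiv f D z"
      using assms unfolding calderon_def by blast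
    then show "\<exists>f'. ((\<lambda>z. apply_bcontfun (f z) j) has_field_derivative f') (at z)"
      using has_cderiv_coord by blast
  qed
qed (use assms in \<open>auto simp: calderon_def\<close>)

lemma calderon_norm_leI:
  assumes "\<And>t::real. norm (f (\<i> * t)) \<le> K" "\<And>t::real. norm_1 (f (1 + \<i> * t)) \<le> K"
  shows "calderon_norm f \<le> K"
  unfolding calderon_norm_def using assms by (intro cSup_least) auto

lemma calderon_norm_ge:
  assumes "f \<in> calderon"
  shows "norm (f (\<i> * complex_of_real t)) \<le> calderon_norm f"
    and "norm_1 (f (1 + \<i> * complex_of_real t)) \<le> calderon_norm f"
proof -
  let ?S = "range (\<lambda>t::real. norm (f (\<i> * t))) \<union> range (\<lambda>t::real. norm_1 (f (1 + \<i> * t)))"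
  obtain M where M: "\<And>z. z \<in> closure strip \<Longrightarrow> norm (f z) \<le> M"
    using calderonD(3)[OF assms] unfolding bounded_iff by auto
  obtain B where B: "\<And>t::real. norm_1 (f (1 + \<i> * t)) \<le> B"
    using assms unfolding calderon_def by auto
  \<comment> \<open>\<open>Sup\<close> dominates the elements of a set only if that set is bounded
    above; both bounds come from membership in \<open>calderon\<close>.\<close>
  have bdd: "bdd_above ?S"
    by (rule bdd_aboveI[of _ "max M B"]) (auto intro!: max.coboundedI1[OF M] max.coboundedI2[OF B])
  show "norm (f (\<i> * complex_of_real t)) \<le> calderon_norm f"
    "norm_1 (f (1 + \<i> * complex_of_real t)) \<le> calderon_norm f"
    unfolding calderon_norm_def by (intro cSup_upper bdd; blast)+
qed

lemma calderon_norm_nonneg: "f \<in> calderon \<Longrightarrow> 0 \<le> calderon_norm f"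
  using calderon_norm_ge(1)[of f 0] norm_ge_zero order_trans by blast

lemma calderon_add:
  assumes f: "f \<in> calderon" and g: "g \<in> calderon"
  shows "(\<lambda>z. f z + g z) \<in> calderon"
    and "calderon_norm (\<lambda>z. f z + g z) \<le> calderon_norm f + calderon_norm g"
proof -
  note F = calderonD[OF f] calderon_norm_ge[OF f] and G = calderonD[OF g] calderon_norm_ge[OF g]
  have n1: "norm_1 (f (1 + \<i> * complex_of_real t) + g (1 + \<i> * complex_of_real t)) \<le> calderon_norm f + calderon_norm g" for t
    using ell_1_add(2)[OF F(4) G(4), of t t] F(7)[of t] G(7)[of t] by linarith
  show "(\<lambda>z. f z + g z) \<in> calderon"
  proof (rule calderonI)
    show "(\<lambda>z. apply_bcontfun (f z + g z) j) holomorphic_on strip" for j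
      using F(1) G(1) by (auto intro: holomorphic_intros)
    show "continuous_on (closure strip) (\<lambda>z. f z + g z)"
      using F(2) G(2) by (intro continuous_intros)
    show "bounded ((\<lambda>z. f z + g z) ` closure strip)"
      using F(3) G(3) by (rule bounded_plus_comp)
    show "f (1 + \<i> * complex_of_real t) + g (1 + \<i> * complex_of_real t) \<in> ell_1" for t
      by (intro ell_1_add F G)
    fix t :: real
    show "((\<lambda>s::real. norm_1 (f (1 + \<i> * s) + g (1 + \<i> * s) - (f (1 + \<i> * t) + g (1 + \<i> * t)))) \<longlongrightarrow> 0) (at t)"
    proof (rule Lim_null_comparison[OF always_eventually])
      show "((\<lambda>s::real. norm_1 (f (1 + \<i> * s) - f (1 + \<i> * t)) + norm_1 (g (1 + \<i> * s) - g (1 + \<i> * t))) \<longlongrightarrow> 0) (at t)"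
        using tendsto_add[OF F(5) G(5)] by simp
      show "\<forall>s::real. norm (norm_1 (f (1 + \<i> * s) + g (1 + \<i> * s) - (f (1 + \<i> * t) + g (1 + \<i> * t))))
        \<le> norm_1 (f (1 + \<i> * s) - f (1 + \<i> * t)) + norm_1 (g (1 + \<i> * s) - g (1 + \<i> * t))"
      proof
        fix s :: real
        have "f (1 + \<i> * s) - f (1 + \<i> * t) \<in> ell_1" "g (1 + \<i> * s) - g (1 + \<i> * t) \<in> ell_1"
          by (intro ell_1_diff F G)+
        from ell_1_add[OF this] norm_1_nonneg
        show "norm (norm_1 (f (1 + \<i> * s) + g (1 + \<i> * s) - (f (1 + \<i> * t) + g (1 + \<i> * t))))
        \<le> norm_1 (f (1 + \<i> * s) - f (1 + \<i> * t)) + norm_1 (g (1 + \<i> * s) - g (1 + \<i> * t))"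
          by (simp add: add_diff_add)
      qed
    qed
  qed (rule n1)
  show "calderon_norm (\<lambda>z. f z + g z) \<le> calderon_norm f + calderon_norm g"
    by (rule calderon_norm_leI) (meson norm_triangle_mono F G n1)+
qed

text \<open>Holomorphy of \<open>\<psi>\<close> on the whole plane gives continuity up to and along
  the edges; boundedness on the closed strip keeps both edge norms finite.\<close>

lemma calderon_mult:
  assumes f: "f \<in> calderon"
    and hol: "\<psi> holomorphic_on UNIV" and bd: "\<And>z. z \<in> closure strip \<Longrightarrow> norm (\<psi> z) \<le> M"
  shows "(\<lambda>z. cscale (\<psi> z) (f z)) \<in> calderon"
proof (rule calderonI)
  note F = calderonD[OF f] calderon_norm_ge[OF f]
  have M: "0 \<le> M" using bd[of "1/2"] strip_subset_closure[OF strip_half] norm_ge_zero order_trans by blast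
  have cont: "continuous_on A \<psi>" for A
    using hol holomorphic_on_imp_continuous_on continuous_on_subset by blast
  show "(\<lambda>z. apply_bcontfun (cscale (\<psi> z) (f z)) j) holomorphic_on strip" for j
    using F(1) holomorphic_on_subset[OF hol] by (auto intro: holomorphic_intros)
  show "continuous_on (closure strip) (\<lambda>z. cscale (\<psi> z) (f z))"
    by (rule bounded_bilinear.continuous_on[OF bounded_bilinear_cscale cont F(2)])
  obtain M' where M': "\<And>z. z \<in> closure strip \<Longrightarrow> norm (f z) \<le> M'"
    using F(3) unfolding bounded_iff by auto
  show "bounded ((\<lambda>z. cscale (\<psi> z) (f z)) ` closure strip)"
    unfolding bounded_iff
    by (auto intro!: exI[of _ "M * M'"] order_trans[OF norm_cscale_le] mult_mono bd M' M)
  show "cscale (\<psi> (1 + \<i> * complex_of_real t)) (f (1 + \<i> * complex_of_real t)) \<in> ell_1" for t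
    by (intro ell_1_cscale F)
  show "norm_1 (cscale (\<psi> (1 + \<i> * complex_of_real t)) (f (1 + \<i> * complex_of_real t)))
      \<le> M * calderon_norm f" for t
    by (subst ell_1_cscale(2)[OF F(4)]) (auto intro!: mult_mono bd F M norm_1_nonneg)
  fix t :: real
  let ?p = "\<lambda>s::real. \<psi> (1 + \<i> * s)" and ?f = "\<lambda>s::real. f (1 + \<i> * s)"
  show "((\<lambda>s. norm_1 (cscale (?p s) (?f s) - cscale (?p t) (?f t))) \<longlongrightarrow> 0) (at t)"
  proof (rule Lim_null_comparison[OF always_eventually])
    have "isCont \<psi> (1 + \<i> * complex_of_real t)"
      using cont[of UNIV] by (simp add: continuous_on_eq_continuous_at)
    then have lim: "((\<lambda>s. ?p s) \<longlongrightarrow> ?p t) (at t)"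
      by (rule isCont_tendsto_compose) (intro tendsto_intros)
    have "((\<lambda>s. norm (?p s) * norm_1 (?f s - ?f t) + norm (?p s - ?p t) * norm_1 (?f t)) \<longlongrightarrow>
        norm (?p t) * 0 + norm (?p t - ?p t) * norm_1 (?f t)) (at t)"
      by (intro tendsto_intros lim F(5))
    then show "((\<lambda>s. norm (?p s) * norm_1 (?f s - ?f t) + norm (?p s - ?p t) * norm_1 (?f t)) \<longlongrightarrow> 0) (at t)"
      by simp
    show "\<forall>s. norm (norm_1 (cscale (?p s) (?f s) - cscale (?p t) (?f t)))
        \<le> norm (?p s) * norm_1 (?f s - ?f t) + norm (?p s - ?p t) * norm_1 (?f t)"
    proof
      fix s
      \<comment> \<open>The usual splitting for the continuity of a product, in which one factor
        moves at a time.\<close>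
      have eq: "cscale (?p s) (?f s) - cscale (?p t) (?f t)
          = cscale (?p s) (?f s - ?f t) + cscale (?p s - ?p t) (?f t)"
        by (rule bcontfun_eqI) (simp add: algebra_simps)
      have m: "?f s - ?f t \<in> ell_1" "?f t \<in> ell_1"
        by (intro ell_1_diff F)+
      show "norm (norm_1 (cscale (?p s) (?f s) - cscale (?p t) (?f t)))
        \<le> norm (?p s) * norm_1 (?f s - ?f t) + norm (?p s - ?p t) * norm_1 (?f t)"
        unfolding eq using ell_1_add[OF ell_1_cscale(1)[OF m(1)] ell_1_cscale(1)[OF m(2)]]
          norm_1_nonneg by (simp add: ell_1_cscale(2)[OF m(1)] ell_1_cscale(2)[OF m(2)])
    qed
  qed
qed

lemma calderon_norm_mult_le:
  assumes f: "f \<in> calderon" and bd: "\<And>z. z \<in> closure strip \<Longrightarrow> norm (\<psi> z) \<le> M"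
  shows "calderon_norm (\<lambda>z. cscale (\<psi> z) (f z)) \<le> M * calderon_norm f"
proof (rule calderon_norm_leI)
  note F = calderonD[OF f] calderon_norm_ge[OF f]
  have M: "0 \<le> M" using bd[of "1/2"] strip_subset_closure[OF strip_half] norm_ge_zero order_trans by blast
  show "norm_1 (cscale (\<psi> (1 + \<i> * complex_of_real t)) (f (1 + \<i> * complex_of_real t)))
      \<le> M * calderon_norm f" for t
    by (subst ell_1_cscale(2)[OF F(4)]) (auto intro!: mult_mono bd F M norm_1_nonneg)
  show "norm (cscale (\<psi> (\<i> * complex_of_real t)) (f (\<i> * complex_of_real t)))
      \<le> M * calderon_norm f" for t
    by (auto intro!: order_trans[OF norm_cscale_le] mult_mono bd F M)
qed

lemma calderon_trunc:
  assumes f: "f \<in> calderon"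
  shows "(\<lambda>z. trunc A (f z)) \<in> calderon"
    and "calderon_norm (\<lambda>z. trunc A (f z)) \<le> calderon_norm f"
proof -
  note F = calderonD[OF f] calderon_norm_ge[OF f]
  have n1: "norm_1 (trunc A (f (1 + \<i> * complex_of_real t))) \<le> calderon_norm f" for t
    using ell_1_trunc(2)[OF F(4)] F(7) order_trans by blast
  show "(\<lambda>z. trunc A (f z)) \<in> calderon"
  proof (rule calderonI)
    show "(\<lambda>z. apply_bcontfun (trunc A (f z)) j) holomorphic_on strip" for j
      using F(1)[of j] by (cases "j \<in> A") auto
    show "continuous_on (closure strip) (\<lambda>z. trunc A (f z))"
      using F(2) by (rule bounded_linear.continuous_on[OF bounded_linear_trunc])
    show "bounded ((\<lambda>z. trunc A (f z)) ` closure strip)"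
      using bounded_linear_image[OF F(3) bounded_linear_trunc] by (simp add: image_image)
    show "trunc A (f (1 + \<i> * complex_of_real t)) \<in> ell_1" for t
      by (intro ell_1_trunc F)
    fix t :: real
    show "((\<lambda>s::real. norm_1 (trunc A (f (1 + \<i> * s)) - trunc A (f (1 + \<i> * t)))) \<longlongrightarrow> 0) (at t)"
    proof (rule Lim_null_comparison[OF always_eventually F(5)[of t]], rule allI)
      fix s :: real
      have m: "f (1 + \<i> * s) - f (1 + \<i> * t) \<in> ell_1"
        by (intro ell_1_diff F)
      have "trunc A (f (1 + \<i> * s)) - trunc A (f (1 + \<i> * t)) = trunc A (f (1 + \<i> * s) - f (1 + \<i> * t))"
        by (rule bcontfun_eqI) simp
      then show "norm (norm_1 (trunc A (f (1 + \<i> * s)) - trunc A (f (1 + \<i> * t))))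
          \<le> norm_1 (f (1 + \<i> * s) - f (1 + \<i> * t))"
        using ell_1_trunc[OF m] norm_1_nonneg by simp
    qed
  qed (rule n1)
  show "calderon_norm (\<lambda>z. trunc A (f z)) \<le> calderon_norm f"
    by (rule calderon_norm_leI) (meson order_trans norm_trunc_le F n1)+
qed

lemma calderon_const:
  assumes "x \<in> ell_1"
  shows "(\<lambda>_. x) \<in> calderon"
  using assms by (intro calderonI[where B = "norm_1 x"]) (auto simp: image_constant_conv)

lemma calderon_unit_seq: "(\<lambda>_. unit_seq i) \<in> calderon" "calderon_norm (\<lambda>_. unit_seq i) \<le> 1"
  by (auto intro!: calderon_const calderon_norm_leI ell_1_unit_seq norm_unit_seq_le simp: norm_1_unit_seq)

lemma calderon_diff:
  assumes f: "f \<in> calderon" and g: "g \<in> calderon"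
  shows "(\<lambda>z. f z - g z) \<in> calderon"
    and "calderon_norm (\<lambda>z. f z - g z) \<le> calderon_norm f + calderon_norm g"
proof -
  have g': "(\<lambda>z. cscale (-1) (g z)) \<in> calderon" "calderon_norm (\<lambda>z. cscale (-1) (g z)) \<le> calderon_norm g"
    using calderon_mult[OF g, of "\<lambda>_. -1" 1] calderon_norm_mult_le[OF g, of "\<lambda>_. -1" 1] by auto
  show "(\<lambda>z. f z - g z) \<in> calderon" "calderon_norm (\<lambda>z. f z - g z) \<le> calderon_norm f + calderon_norm g"
    using calderon_add[OF f g'(1)] g'(2) by (simp_all add: minus_eq_cscale)
qed

lemma calderon_sum:
  assumes "\<And>i. i \<in> I \<Longrightarrow> f i \<in> calderon"
  shows "(\<lambda>z. \<Sum>i\<in>I. f i z) \<in> calderon"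
    and "calderon_norm (\<lambda>z. \<Sum>i\<in>I. f i z) \<le> (\<Sum>i\<in>I. calderon_norm (f i))"
proof -
  have 0: "(\<lambda>_. 0) \<in> calderon" "calderon_norm (\<lambda>_. 0) \<le> 0"
    by (auto intro!: calderon_const calderon_norm_leI)
  have "(\<lambda>z. \<Sum>i\<in>I. f i z) \<in> calderon \<and>
      calderon_norm (\<lambda>z. \<Sum>i\<in>I. f i z) \<le> (\<Sum>i\<in>I. calderon_norm (f i))"
    using assms
  proof (induction I rule: infinite_finite_induct)
    case (insert x F)
    then show ?case
      using calderon_add[of "f x" "\<lambda>z. \<Sum>i\<in>F. f i z"] by force
  qed (use 0 in auto)
  then show "(\<lambda>z. \<Sum>i\<in>I. f i z) \<in> calderon"
    "calderon_norm (\<lambda>z. \<Sum>i\<in>I. f i z) \<le> (\<Sum>i\<in>I. calderon_norm (f i))" by auto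
qed

section \<open>Three lines and Taylor coefficients\<close>

text \<open>The strip is unbounded, so the maximum principle is applied on the rectangle between
  heights \<open>- R\<close> and \<open>R\<close>, after multiplication by
  \<open>exp ((w\<^sup>2 - 1) / R)\<close>. This factor has modulus at most \<open>1\<close> on the
  closed strip and at most \<open>exp (- R)\<close> on the horizontal sides, and its modulus at
  \<open>z\<close> tends to \<open>1\<close> as \<open>R\<close> grows.\<close>

lemma three_lines_bound:
  assumes hol: "h holomorphic_on strip" and cont: "continuous_on (closure strip) h"
    and bd: "bounded (h ` closure strip)"
    and 0: "\<And>t::real. norm (h (\<i> * t)) \<le> K" and 1: "\<And>t::real. norm (h (1 + \<i> * t)) \<le> K"
    and z: "z \<in> strip"
  shows "norm (h z) \<le> K"
proof -
  obtain M where M: "\<And>z. z \<in> closure strip \<Longrightarrow> norm (h z) \<le> M"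
    using bd unfolding bounded_iff by auto
  have K: "0 \<le> K" using 0[of 0] norm_ge_zero order_trans by blast
  have M0: "0 \<le> M" using M[OF strip_subset_closure[OF z]] norm_ge_zero order_trans by blast
  have ne: "norm (exp (complex_of_real (1 / R) * (w\<^sup>2 - 1))) = exp (((Re w)\<^sup>2 - (Im w)\<^sup>2 - 1) / R)" for R w
    by (simp add: power2_eq_square)
  have *: "norm (h z) * exp (((Re z)\<^sup>2 - (Im z)\<^sup>2 - 1) / R) \<le> K + M * exp (- R)" if R: "R > \<bar>Im z\<bar>" "R > 0" for R
  proof -
    let ?S = "cbox (Complex 0 (- R)) (Complex 1 R)"
    let ?g = "\<lambda>w. h w * exp (complex_of_real (1 / R) * (w\<^sup>2 - 1))"
    have S: "w \<in> ?S \<longleftrightarrow> 0 \<le> Re w \<and> Re w \<le> 1 \<and> - R \<le> Im w \<and> Im w \<le> R" for w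
      by (auto simp: in_cbox_complex_iff)
    have B: "w \<in> box (Complex 0 (- R)) (Complex 1 R) \<longleftrightarrow> 0 < Re w \<and> Re w < 1 \<and> - R < Im w \<and> Im w < R" for w
      by (auto simp: in_box_complex_iff)
    have "norm (?g z) \<le> K + M * exp (- R)"
    proof (rule maximum_modulus_frontier[of ?g ?S])
      have "interior ?S \<subseteq> strip"
        unfolding interior_cbox by (auto simp: B strip_def)
      then show "?g holomorphic_on interior ?S"
        by (intro holomorphic_intros holomorphic_on_subset[OF hol])
      have "closure ?S \<subseteq> closure strip"
        by (auto simp: closure_strip S)
      then show "continuous_on (closure ?S) ?g"
        by (intro continuous_intros continuous_on_subset[OF cont])
      show "bounded ?S" by (rule bounded_cbox)
      show "z \<in> ?S" using z R by (auto simp: S strip_def)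
      fix w assume "w \<in> frontier ?S"
      then have w: "w \<in> ?S" "w \<notin> box (Complex 0 (- R)) (Complex 1 R)"
        by (auto simp: frontier_def interior_cbox)
      then have cl: "w \<in> closure strip" by (auto simp: S closure_strip)
      have Re2: "(Re w)\<^sup>2 \<le> 1" using w by (auto simp: S power_le_one)
      consider "Re w = 0" | "Re w = 1" | "\<bar>Im w\<bar> = R"
        using w by (auto simp: S B)
      then show "norm (?g w) \<le> K + M * exp (- R)"
      proof cases
        case 3
        then have "(Im w)\<^sup>2 = R\<^sup>2" by auto
        then have "((Re w)\<^sup>2 - (Im w)\<^sup>2 - 1) / R \<le> - R"
          using Re2 R by (simp add: divide_simps power2_eq_square)
        then have "norm (?g w) \<le> M * exp (- R)"
          unfolding norm_mult ne using M[OF cl] M0 by (intro mult_mono) auto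
        then show ?thesis using K by simp
      next
        case 1
        then have "w = \<i> * complex_of_real (Im w)" by (simp add: complex_eq_iff)
        then have "norm (h w) \<le> K" using 0[of "Im w"] by metis
        moreover have "((Re w)\<^sup>2 - (Im w)\<^sup>2 - 1) / R \<le> 0"
          using Re2 R by (simp add: divide_le_0_iff) (smt (verit) zero_le_power2)
        ultimately have "norm (?g w) \<le> K * 1"
          unfolding norm_mult ne using K by (intro mult_mono) auto
        then show ?thesis using M0 by (smt (verit) exp_gt_zero mult_nonneg_nonneg)
      next
        case 2
        then have "w = 1 + \<i> * complex_of_real (Im w)" by (simp add: complex_eq_iff)
        then have "norm (h w) \<le> K" using 1[of "Im w"] by metis
        moreover have "((Re w)\<^sup>2 - (Im w)\<^sup>2 - 1) / R \<le> 0"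
          using Re2 R by (simp add: divide_le_0_iff) (smt (verit) zero_le_power2)
        ultimately have "norm (?g w) \<le> K * 1"
          unfolding norm_mult ne using K by (intro mult_mono) auto
        then show ?thesis using M0 by (smt (verit) exp_gt_zero mult_nonneg_nonneg)
      qed
    qed
    then show ?thesis by (simp only: norm_mult ne)
  qed
  have "((\<lambda>R. norm (h z) * exp (((Re z)\<^sup>2 - (Im z)\<^sup>2 - 1) / R)) \<longlongrightarrow> norm (h z) * exp 0) at_top"
    by (intro tendsto_intros tendsto_divide_0[OF tendsto_const] filterlim_at_top_imp_at_infinity filterlim_ident)
  moreover have "((\<lambda>R. K + M * exp (- R)) \<longlongrightarrow> K + M * 0) at_top"
    by (intro tendsto_intros filterlim_compose[OF exp_at_bot] filterlim_uminus_at_bot_at_top)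
  moreover have "eventually (\<lambda>R. norm (h z) * exp (((Re z)\<^sup>2 - (Im z)\<^sup>2 - 1) / R) \<le> K + M * exp (- R)) at_top"
    using eventually_gt_at_top[of "\<bar>Im z\<bar>"] eventually_gt_at_top[of 0] by eventually_elim (rule *)
  ultimately have "norm (h z) * exp 0 \<le> K + M * 0"
    by (intro tendsto_le[OF trivial_limit_at_top_linorder])
  then show ?thesis by simp
qed

section \<open>Scalar Taylor coefficients at \<open>1/2\<close>\<close>

definition taylor_coeff :: "nat \<Rightarrow> (complex \<Rightarrow> complex) \<Rightarrow> complex"
  where "taylor_coeff l g = (deriv ^^ l) g (1/2) / fact l"

lemma taylor_coeff_add:
  assumes "f holomorphic_on strip" "g holomorphic_on strip"
  shows "taylor_coeff l (\<lambda>z. f z + g z) = taylor_coeff l f + taylor_coeff l g"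
  unfolding taylor_coeff_def using higher_deriv_add[OF assms open_strip strip_half]
  by (simp add: add_divide_distrib)

lemma taylor_coeff_diff:
  assumes "f holomorphic_on strip" "g holomorphic_on strip"
  shows "taylor_coeff l (\<lambda>z. f z - g z) = taylor_coeff l f - taylor_coeff l g"
  unfolding taylor_coeff_def using higher_deriv_diff[OF assms open_strip strip_half]
  by (simp add: diff_divide_distrib)

lemma taylor_coeff_cmult:
  assumes "f holomorphic_on strip"
  shows "taylor_coeff l (\<lambda>z. c * f z) = c * taylor_coeff l f"
  unfolding taylor_coeff_def using higher_deriv_cmult[OF assms strip_half open_strip] by simp

lemma taylor_coeff_const: "taylor_coeff l (\<lambda>_. c) = (if l = 0 then c else 0)"
  by (simp add: taylor_coeff_def)

lemma taylor_coeff_sum: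
  assumes "\<And>i. i \<in> I \<Longrightarrow> f i holomorphic_on strip"
  shows "taylor_coeff l (\<lambda>z. \<Sum>i\<in>I. f i z) = (\<Sum>i\<in>I. taylor_coeff l (f i))"
  using assms
proof (induction I rule: infinite_finite_induct)
  case (insert x F)
  then show ?case
    by (simp add: taylor_coeff_add holomorphic_on_sum)
qed (auto simp: taylor_coeff_const)

lemma taylor_coeff_mult:
  assumes "f holomorphic_on strip" "g holomorphic_on strip"
  shows "taylor_coeff l (\<lambda>z. f z * g z) = (\<Sum>i\<le>l. taylor_coeff i f * taylor_coeff (l - i) g)"
proof -
  have "of_nat (l choose i) * a * b / fact l = a / fact i * (b / fact (l - i))"
    if "i \<le> l" for i and a b :: complex
    using binomial_fact[OF that, where 'a = complex] by simp
  then show ?thesis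
    unfolding taylor_coeff_def higher_deriv_mult[OF assms open_strip strip_half] sum_divide_distrib
    by (simp add: atMost_atLeast0)
qed

text \<open>The constant \<open>4 ^ l\<close> comes from Cauchy's inequality on the circle of radius
  \<open>1/4\<close> about \<open>1/2\<close>, which lies in the strip.\<close>

lemma norm_taylor_coeff_le:
  assumes "h holomorphic_on strip" "\<And>z. z \<in> strip \<Longrightarrow> norm (h z) \<le> K"
  shows "norm (taylor_coeff l h) \<le> 4 ^ l * K"
proof -
  have sub: "cball (1/2) (1/4) \<subseteq> strip"
  proof
    fix z :: complex assume "z \<in> cball (1/2) (1/4)"
    then have "\<bar>1/2 - Re z\<bar> \<le> 1/4"
      using abs_Re_le_cmod[of "1/2 - z"] by (simp add: dist_norm)
    then show "z \<in> strip"
      unfolding strip_def mem_Collect_eq by linarith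
  qed
  have "norm ((deriv ^^ l) h (1/2)) \<le> fact l * K / (1/4) ^ l"
  proof (rule Cauchy_inequality)
    show "h holomorphic_on ball (1/2) (1/4)"
      using assms(1) sub ball_subset_cball by (meson holomorphic_on_subset subset_trans)
    show "continuous_on (cball (1/2) (1/4)) h"
      using assms(1) sub by (meson holomorphic_on_subset holomorphic_on_imp_continuous_on)
    show "cmod (h x) \<le> K" if "cmod (1/2 - x) = 1/4" for x
      using that by (intro assms(2) subsetD[OF sub]) (simp add: dist_norm)
  qed simp
  then show ?thesis
    by (simp add: taylor_coeff_def norm_divide field_simps power_one_over)
qed

text \<open>The three lines bound is applied to one coordinate at a time; on the right edge the
  coordinate is dominated by \<open>norm_1\<close>. This turns the two edge norms into a pointwise
  bound inside the strip.\<close>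

lemma calderon_coord_le:
  assumes "f \<in> calderon" "z \<in> strip"
  shows "norm (apply_bcontfun (f z) j) \<le> calderon_norm f"
proof (rule three_lines_bound[OF _ _ _ _ _ assms(2)])
  note F = calderonD[OF assms(1)] calderon_norm_ge[OF assms(1)]
  show "continuous_on (closure strip) (\<lambda>z. apply_bcontfun (f z) j)"
    by (rule bounded_linear.continuous_on[OF bounded_linear_coord F(2)])
  show "bounded ((\<lambda>z. apply_bcontfun (f z) j) ` closure strip)"
    using bounded_linear_image[OF F(3) bounded_linear_coord] by (simp add: image_image)
  show "norm (apply_bcontfun (f (\<i> * complex_of_real t)) j) \<le> calderon_norm f" for t
    using norm_bounded F order_trans by blast
  show "norm (apply_bcontfun (f (1 + \<i> * complex_of_real t)) j) \<le> calderon_norm f" for t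
    using norm_coord_le_norm_1 F order_trans by blast
qed (use calderonD[OF assms(1)] in auto)

lemma calderon_taylor_coeff_le:
  assumes "f \<in> calderon"
  shows "norm (taylor_coeff l (\<lambda>z. apply_bcontfun (f z) j)) \<le> 4 ^ l * calderon_norm f"
  by (intro norm_taylor_coeff_le calderonD calderon_coord_le assms)

lemma taylor_tuple_coord:
  assumes "f \<in> calderon"
  shows "apply_bcontfun (taylor_tuple n f i) j
    = (if i < n then taylor_coeff (n - 1 - i) (\<lambda>z. apply_bcontfun (f z) j) else 0)"
proof -
  have "apply_bcontfun ((cderiv ^^ l) f (1/2)) j = (deriv ^^ l) (\<lambda>w. apply_bcontfun (f w) j) (1/2)" for l
    by (rule higher_cderiv_coord[OF calderonD(1)[OF assms] calderon_coord_le[OF assms] strip_half])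
  then show ?thesis
    by (simp add: taylor_tuple_def taylor_coeff_def scaleR_conv_of_real field_simps)
qed

text \<open>Removes both the reversed order of the entries and the vector-valued derivatives, so
  that jets can be compared through scalar Taylor coefficients.\<close>

lemma taylor_tuple_eq_iff:
  assumes "f \<in> calderon" "g \<in> calderon"
  shows "taylor_tuple n f = taylor_tuple n g \<longleftrightarrow>
    (\<forall>l<n. \<forall>j. taylor_coeff l (\<lambda>z. apply_bcontfun (f z) j) = taylor_coeff l (\<lambda>z. apply_bcontfun (g z) j))"
    (is "?L \<longleftrightarrow> ?R")
proof
  assume ?L
  show ?R
  proof (intro allI impI)
    fix l j assume "l < n"
    then have "n - 1 - l < n" "n - 1 - (n - 1 - l) = l" by auto
    then show "taylor_coeff l (\<lambda>z. apply_bcontfun (f z) j) = taylor_coeff l (\<lambda>z. apply_bcontfun (g z) j)"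
      using arg_cong[OF \<open>?L\<close>, of "\<lambda>x. apply_bcontfun (x (n - 1 - l)) j"] assms
      by (simp add: taylor_tuple_coord)
  qed
next
  assume ?R
  then show ?L
    using assms by (intro ext bcontfun_eqI) (auto simp: taylor_tuple_coord)
qed

section \<open>Multiplying jets by scalar functions\<close>

lemma power_le_fact_exp:
  fixes x :: real
  assumes "x \<ge> 0"
  shows "x ^ l \<le> fact l * exp x"
proof -
  have "(\<Sum>i\<in>{l}. x ^ i /\<^sub>R fact i) \<le> (\<Sum>i. x ^ i /\<^sub>R fact i)"
    using assms by (intro sum_le_suminf summable_exp_generic) auto
  then show ?thesis
    by (simp add: exp_def field_simps)
qed

lemma taylor_coeff_power: "taylor_coeff i (\<lambda>z. (z - 1/2) ^ l) = (if i = l then 1 else 0)"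
proof -
  have "(deriv ^^ i) (\<lambda>z. (z - 1/2) ^ l) (1/2) = (pochhammer (of_nat (Suc l - i)) i * 0 ^ (l - i) :: complex)"
    using higher_deriv_power[of i "1/2" l "1/2"] by simp
  also have "\<dots> = (if i = l then fact l else 0)"
  proof (cases i l rule: linorder_cases)
    \<comment> \<open>For \<open>i > l\<close> the truncated difference \<open>Suc l - i\<close> is
      \<open>0\<close>, and the Pochhammer symbol at \<open>0\<close> vanishes.\<close>
    case greater
    then show ?thesis by (simp add: pochhammer_0_left)
  qed (auto simp: pochhammer_fact)
  finally show ?thesis by (simp add: taylor_coeff_def)
qed

lemma taylor_coeff_exp: "taylor_coeff l (\<lambda>z. exp (c * (z - 1/2))) = c ^ l / fact l"
proof -
  have "(deriv ^^ l) (\<lambda>z. exp (c * (z - 1/2))) = (\<lambda>z. c ^ l * exp (c * (z - 1/2)))"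
  proof (induction l)
    case (Suc l)
    have "deriv (\<lambda>z. c ^ l * exp (c * (z - 1/2))) z = c ^ Suc l * exp (c * (z - 1/2))" for z
      by (rule DERIV_imp_deriv) (auto intro!: derivative_eq_intros)
    then show ?case by (simp add: Suc.IH)
  qed simp
  then show ?thesis by (simp add: taylor_coeff_def)
qed

lemma norm_exp_gauss:
  "norm (exp ((z - 1/2)\<^sup>2)) = exp ((Re z - 1/2)\<^sup>2 - (Im z)\<^sup>2)"
  by (simp add: power2_eq_square)

text \<open>The Gaussian decays like \<open>exp (- (Im z)\<^sup>2)\<close> along the strip, while
  the power grows no faster than \<open>fact l * exp (1/2 + y)\<close> with
  \<open>y = \<bar>Im z\<bar>\<close>. Completing the square in \<open>y\<close> gives the explicit
  bound.\<close>

lemma power_times_gauss_bounded: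
  assumes "z \<in> closure strip"
  shows "norm ((z - 1/2) ^ l * exp ((z - 1/2)\<^sup>2)) \<le> fact l * exp 1"
proof -
  define y where "y = \<bar>Im z\<bar>"
  have "0 \<le> Re z" "Re z \<le> 1" using assms by (auto simp: closure_strip)
  then have x: "\<bar>Re z - 1/2\<bar> \<le> 1/2" by linarith
  have "norm (z - 1/2) \<le> 1/2 + y"
    using cmod_le[of "z - 1/2"] x by (simp add: y_def)
  then have "norm (z - 1/2) ^ l \<le> (1/2 + y) ^ l"
    by (intro power_mono) auto
  also have "\<dots> \<le> fact l * exp (1/2 + y)"
    by (rule power_le_fact_exp) (simp add: y_def)
  finally have 1: "norm (z - 1/2) ^ l \<le> fact l * exp (1/2 + y)" .
  have "(Re z - 1/2)\<^sup>2 \<le> (1/2)\<^sup>2" using x by (intro abs_le_square_iff[THEN iffD1]) auto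
  then have 2: "norm (exp ((z - 1/2)\<^sup>2)) \<le> exp (1/4 - y\<^sup>2)"
    unfolding norm_exp_gauss by (simp add: y_def power2_eq_square)
  have "norm ((z - 1/2) ^ l * exp ((z - 1/2)\<^sup>2)) \<le> fact l * exp (1/2 + y) * exp (1/4 - y\<^sup>2)"
    unfolding norm_mult norm_power by (intro mult_mono 1 2) auto
  also have "\<dots> = fact l * exp (1/2 + y + (1/4 - y\<^sup>2))"
    by (simp only: exp_add mult.assoc)
  also have "\<dots> \<le> fact l * exp 1"
  proof -
    have "0 \<le> (y - 1/2)\<^sup>2" by simp
    then have "1/2 + y + (1/4 - y\<^sup>2) \<le> 1" by (simp add: power2_eq_square algebra_simps)
    then show ?thesis by simp
  qed
  finally show ?thesis .
qed

text \<open>For \<open>l > 0\<close> the monomial \<open>(z - 1/2) ^ l\<close> is unbounded on the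
  strip, so it is damped by a Gaussian. This preserves the coefficients of order up to
  \<open>l\<close> and disturbs only those beyond. They are corrected with the functions already
  built for larger orders, whence the induction on \<open>n - l\<close>.\<close>

lemma exists_bounded_monomial:
  assumes "l < n"
  shows "\<exists>b M. b holomorphic_on UNIV \<and> (\<forall>z\<in>closure strip. norm (b z) \<le> M) \<and>
    (\<forall>r<n. taylor_coeff r b = (if r = l then 1 else 0))"
  using assms
proof (induction "n - l" arbitrary: l rule: less_induct)
  case less
  have "\<forall>i\<in>{l<..<n}. \<exists>b M. b holomorphic_on UNIV \<and> (\<forall>z\<in>closure strip. norm (b z) \<le> M) \<and>
    (\<forall>r<n. taylor_coeff r b = (if r = i then 1 else 0))"
    by (intro ballI less.hyps) (use less.prems in auto)
  then obtain b M where bM: "\<forall>i\<in>{l<..<n}. b i holomorphic_on UNIV \<and>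
    (\<forall>z\<in>closure strip. norm (b i z) \<le> M i) \<and> (\<forall>r<n. taylor_coeff r (b i) = (if r = i then 1 else 0))"
    unfolding bchoice_iff by blast
  have M: "norm (b i z) \<le> M i" if "i \<in> {l<..<n}" "z \<in> closure strip" for i z
    using bM that by blast
  have tb: "taylor_coeff r (b i) = (if r = i then 1 else 0)" if "i \<in> {l<..<n}" "r < n" for i r
    using bM that by blast
  let ?E = "\<lambda>z. exp ((z - 1/2)\<^sup>2) :: complex"
  define g where "g = (\<lambda>z. (z - 1/2) ^ l * ?E z)"
  have hg: "g holomorphic_on A" for A
    unfolding g_def by (intro holomorphic_intros)
  have tg: "taylor_coeff r g = (if r < l then 0 else taylor_coeff (r - l) ?E)" for r
  proof -
    have "taylor_coeff r g = (\<Sum>i\<le>r. taylor_coeff i (\<lambda>z. (z - 1/2) ^ l) * taylor_coeff (r - i) ?E)"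
      unfolding g_def by (rule taylor_coeff_mult) (intro holomorphic_intros)+
    also have "\<dots> = (\<Sum>i\<le>r. if i = l then taylor_coeff (r - i) ?E else 0)"
      unfolding taylor_coeff_power by (intro sum.cong) auto
    finally show ?thesis by auto
  qed
  define B where "B = (\<lambda>z. g z - (\<Sum>i\<in>{l<..<n}. taylor_coeff i g * b i z))"
  have hb: "b i holomorphic_on A" if "i \<in> {l<..<n}" for i A
    using bM that holomorphic_on_subset by blast
  have "B holomorphic_on UNIV"
    unfolding B_def by (intro holomorphic_intros hg hb)
  moreover have "norm (B z) \<le> fact l * exp 1 + (\<Sum>i\<in>{l<..<n}. norm (taylor_coeff i g) * M i)"
    if z: "z \<in> closure strip" for z
  proof -
    have "norm (B z) \<le> norm (g z) + (\<Sum>i\<in>{l<..<n}. norm (taylor_coeff i g * b i z))"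
      unfolding B_def by (intro order_trans[OF norm_triangle_ineq4] add_left_mono norm_sum)
    also have "\<dots> \<le> fact l * exp 1 + (\<Sum>i\<in>{l<..<n}. norm (taylor_coeff i g) * M i)"
    proof (intro add_mono sum_mono)
      show "norm (g z) \<le> fact l * exp 1"
        unfolding g_def by (rule power_times_gauss_bounded[OF z])
      show "norm (taylor_coeff i g * b i z) \<le> norm (taylor_coeff i g) * M i" if "i \<in> {l<..<n}" for i
        unfolding norm_mult by (intro mult_left_mono M that z) auto
    qed
    finally show ?thesis .
  qed
  moreover have "taylor_coeff r B = (if r = l then 1 else 0)" if "r < n" for r
  proof -
    have "taylor_coeff r B = taylor_coeff r g - (\<Sum>i\<in>{l<..<n}. taylor_coeff i g * taylor_coeff r (b i))"
    proof -
      have "taylor_coeff r B = taylor_coeff r g - taylor_coeff r (\<lambda>z. \<Sum>i\<in>{l<..<n}. taylor_coeff i g * b i z)"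
        unfolding B_def by (rule taylor_coeff_diff) (intro holomorphic_intros hg hb)+
      also have "taylor_coeff r (\<lambda>z. \<Sum>i\<in>{l<..<n}. taylor_coeff i g * b i z) = (\<Sum>i\<in>{l<..<n}. taylor_coeff r (\<lambda>z. taylor_coeff i g * b i z))"
        by (rule taylor_coeff_sum) (intro holomorphic_intros hb)
      also have "\<dots> = (\<Sum>i\<in>{l<..<n}. taylor_coeff i g * taylor_coeff r (b i))"
        by (intro sum.cong taylor_coeff_cmult hb refl)
      finally show ?thesis .
    qed
    also have "(\<Sum>i\<in>{l<..<n}. taylor_coeff i g * taylor_coeff r (b i)) = (\<Sum>i\<in>{l<..<n}. if i = r then taylor_coeff r g else 0)"
      using tb that by (intro sum.cong) auto
    \<comment> \<open>The sum cancels the orders above \<open>l\<close>; at order \<open>l\<close>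
      the coefficient is the value of the Gaussian at \<open>1/2\<close>, which is
      \<open>1\<close>.\<close>
    also have "taylor_coeff r g - \<dots> = (if r = l then 1 else 0)"
      using that tg[of r] by (auto simp: taylor_coeff_def[of 0])
    finally show ?thesis .
  qed
  ultimately show ?case by blast
qed

text \<open>On coefficients of order below \<open>n\<close>, multiplication by a scalar function
  depends only on its own first \<open>n\<close> coefficients. The multiplier can thus be taken as
  the combination of bounded monomials with coefficients \<open>a\<close>. The cost is linear in
  \<open>a\<close>, with \<open>C\<close> independent of \<open>f\<close> and
  \<open>a\<close>.\<close>

lemma jet_multiplier:
  "\<exists>C\<ge>0. \<forall>f\<in>calderon. \<forall>a. \<exists>g\<in>calderon.
    calderon_norm g \<le> C * (\<Sum>l<n. norm (a l)) * calderon_norm f \<and>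
    (\<forall>r<n. \<forall>j. taylor_coeff r (\<lambda>z. apply_bcontfun (g z) j)
      = (\<Sum>i\<le>r. a i * taylor_coeff (r - i) (\<lambda>z. apply_bcontfun (f z) j)))"
proof -
  have "\<forall>l\<in>{..<n}. \<exists>b M. b holomorphic_on UNIV \<and> (\<forall>z\<in>closure strip. norm (b z) \<le> M) \<and>
    (\<forall>r<n. taylor_coeff r b = (if r = l then 1 else 0))"
    using exists_bounded_monomial by blast
  then obtain b M where bM: "\<forall>l\<in>{..<n}. b l holomorphic_on UNIV \<and>
    (\<forall>z\<in>closure strip. norm (b l z) \<le> M l) \<and> (\<forall>r<n. taylor_coeff r (b l) = (if r = l then 1 else 0))"
    unfolding bchoice_iff by blast
  have M: "norm (b l z) \<le> M l" if "l < n" "z \<in> closure strip" for l z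
    using bM that by blast
  have tb: "taylor_coeff r (b l) = (if r = l then 1 else 0)" if "l < n" "r < n" for l r
    using bM that by blast
  have M0: "0 \<le> M l" if "l < n" for l
    using M[OF that strip_subset_closure[OF strip_half]] norm_ge_zero order_trans by blast
  have hb: "b i holomorphic_on A" if "i < n" for i A
    using bM that holomorphic_on_subset by blast
  define C where "C = (\<Sum>l<n. M l)"
  show ?thesis
  proof (intro exI[of _ C] conjI ballI allI)
    show "0 \<le> C" unfolding C_def using M0 by (intro sum_nonneg) auto
    fix f :: "complex \<Rightarrow> ell_infty" and a :: "nat \<Rightarrow> complex"
    assume f: "f \<in> calderon"
    define \<psi> where "\<psi> = (\<lambda>z. \<Sum>l<n. a l * b l z)"
    have h\<psi>: "\<psi> holomorphic_on A" for A
      unfolding \<psi>_def by (intro holomorphic_intros hb) auto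
    have \<psi>: "norm (\<psi> z) \<le> C * (\<Sum>l<n. norm (a l))" if "z \<in> closure strip" for z
    proof -
      have "M l \<le> C" if "l < n" for l
        unfolding C_def using M0 that by (intro member_le_sum) auto
      then have "norm (b l z) \<le> C" if "l < n" for l
        using M[OF that \<open>z \<in> closure strip\<close>] that order_trans by blast
      then have "norm (\<psi> z) \<le> (\<Sum>l<n. norm (a l) * C)"
        unfolding \<psi>_def by (intro order_trans[OF norm_sum] sum_mono) (auto simp: norm_mult intro!: mult_left_mono)
      then show ?thesis by (simp add: sum_distrib_left mult.commute)
    qed
    have t\<psi>: "taylor_coeff r \<psi> = a r" if "r < n" for r
    proof -
      have "taylor_coeff r \<psi> = (\<Sum>l<n. a l * taylor_coeff r (b l))"
        unfolding \<psi>_def by (subst taylor_coeff_sum) (auto intro!: holomorphic_intros hb sum.cong taylor_coeff_cmult)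
      also have "\<dots> = (\<Sum>l<n. if l = r then a r else 0)"
        using tb that by (intro sum.cong) auto
      finally show ?thesis using that by simp
    qed
    let ?g = "\<lambda>z. cscale (\<psi> z) (f z)"
    show "\<exists>g\<in>calderon. calderon_norm g \<le> C * (\<Sum>l<n. norm (a l)) * calderon_norm f \<and>
      (\<forall>r<n. \<forall>j. taylor_coeff r (\<lambda>z. apply_bcontfun (g z) j)
      = (\<Sum>i\<le>r. a i * taylor_coeff (r - i) (\<lambda>z. apply_bcontfun (f z) j)))"
    proof (intro bexI[of _ ?g] conjI allI impI)
      show "?g \<in> calderon" by (rule calderon_mult[OF f h\<psi> \<psi>])
      show "calderon_norm ?g \<le> C * (\<Sum>l<n. norm (a l)) * calderon_norm f"
        by (rule calderon_norm_mult_le[OF f \<psi>])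
      fix r j assume "r < n"
      then show "taylor_coeff r (\<lambda>z. apply_bcontfun (?g z) j)
          = (\<Sum>i\<le>r. a i * taylor_coeff (r - i) (\<lambda>z. apply_bcontfun (f z) j))"
        by (simp add: taylor_coeff_mult[OF h\<psi> calderonD(1)[OF f]] t\<psi>)
    qed
  qed
qed

text \<open>The quotient norm of the tuple represented by \<open>f\<close> is at most \<open>K\<close>, with the infimum attained.\<close>

definition jet_le :: "nat \<Rightarrow> (complex \<Rightarrow> ell_infty) \<Rightarrow> real \<Rightarrow> bool"
  where "jet_le n f K \<longleftrightarrow>
    (\<exists>g\<in>calderon. calderon_norm g \<le> K \<and> taylor_tuple n g = taylor_tuple n f)"

lemma jet_le_refl: "f \<in> calderon \<Longrightarrow> jet_le n f (calderon_norm f)"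
  unfolding jet_le_def by blast

lemma jet_le_mono: "jet_le n f K \<Longrightarrow> K \<le> K' \<Longrightarrow> jet_le n f K'"
  unfolding jet_le_def by (meson order_trans)

section \<open>Arithmetic of jet bounds\<close>

lemma taylor_tuple_add:
  assumes "f \<in> calderon" "g \<in> calderon"
  shows "taylor_tuple n (\<lambda>z. f z + g z) = (\<lambda>i. taylor_tuple n f i + taylor_tuple n g i)"
  by (intro ext bcontfun_eqI)
    (simp add: taylor_tuple_coord calderon_add assms taylor_coeff_add calderonD(1))

lemma taylor_tuple_diff:
  assumes "f \<in> calderon" "g \<in> calderon"
  shows "taylor_tuple n (\<lambda>z. f z - g z) = (\<lambda>i. taylor_tuple n f i - taylor_tuple n g i)"
  by (intro ext bcontfun_eqI)
    (simp add: taylor_tuple_coord calderon_diff assms taylor_coeff_diff calderonD(1))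

lemma apply_bcontfun_sum:
  fixes f :: "'a \<Rightarrow> ell_infty"
  shows "apply_bcontfun (\<Sum>i\<in>I. f i) j = (\<Sum>i\<in>I. apply_bcontfun (f i) j)"
  by (induction I rule: infinite_finite_induct) auto

lemma taylor_tuple_sum:
  assumes "\<And>i. i \<in> I \<Longrightarrow> f i \<in> calderon"
  shows "taylor_tuple n (\<lambda>z. \<Sum>i\<in>I. f i z) = (\<lambda>k. \<Sum>i\<in>I. taylor_tuple n (f i) k)"
  by (intro ext bcontfun_eqI)
    (simp add: taylor_tuple_coord calderon_sum assms apply_bcontfun_sum taylor_coeff_sum calderonD(1))

lemma jet_le_add:
  assumes "jet_le n f K" "jet_le n g L" "f \<in> calderon" "g \<in> calderon"
  shows "jet_le n (\<lambda>z. f z + g z) (K + L)"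
proof -
  obtain f' g' where "f' \<in> calderon" "calderon_norm f' \<le> K" "taylor_tuple n f' = taylor_tuple n f"
    "g' \<in> calderon" "calderon_norm g' \<le> L" "taylor_tuple n g' = taylor_tuple n g"
    using assms unfolding jet_le_def by blast
  then show ?thesis
    unfolding jet_le_def using assms calderon_add[of f' g'] taylor_tuple_add[of f' g' n]
    by (intro bexI[of _ "\<lambda>z. f' z + g' z"]) (auto simp: taylor_tuple_add)
qed

lemma jet_le_sum:
  assumes "\<And>i. i \<in> I \<Longrightarrow> jet_le n (f i) (K i)" "\<And>i. i \<in> I \<Longrightarrow> f i \<in> calderon"
  shows "jet_le n (\<lambda>z. \<Sum>i\<in>I. f i z) (\<Sum>i\<in>I. K i)"
proof -
  have "\<forall>i\<in>I. \<exists>g. g \<in> calderon \<and> calderon_norm g \<le> K i \<and> taylor_tuple n g = taylor_tuple n (f i)"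
    using assms(1) unfolding jet_le_def by blast
  then obtain g where g: "\<And>i. i \<in> I \<Longrightarrow> g i \<in> calderon" "\<And>i. i \<in> I \<Longrightarrow> calderon_norm (g i) \<le> K i"
    "\<And>i. i \<in> I \<Longrightarrow> taylor_tuple n (g i) = taylor_tuple n (f i)"
    unfolding bchoice_iff by blast
  have "calderon_norm (\<lambda>z. \<Sum>i\<in>I. g i z) \<le> (\<Sum>i\<in>I. K i)"
    using calderon_sum(2)[of I g] sum_mono[of I "\<lambda>i. calderon_norm (g i)" K] g by force
  then show ?thesis
    unfolding jet_le_def using g assms(2)
    by (intro bexI[of _ "\<lambda>z. \<Sum>i\<in>I. g i z"]) (auto simp: taylor_tuple_sum calderon_sum)
qed

text \<open>Multiplication by \<open>\<psi>\<close> is undone by its inverse \<open>\<phi>\<close>,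
  and \<open>jet_multiplier\<close> charges only for the jet of \<open>\<phi>\<close> at
  \<open>1/2\<close>. Hence \<open>\<phi>\<close> may be large, or even unbounded, on the
  strip.\<close>

lemma jet_le_divide:
  "\<exists>C\<ge>0. \<forall>f\<in>calderon. \<forall>\<psi> \<phi> K. \<psi> holomorphic_on strip \<longrightarrow> \<phi> holomorphic_on strip \<longrightarrow>
    (\<forall>z. \<phi> z * \<psi> z = 1) \<longrightarrow> (\<lambda>z. cscale (\<psi> z) (f z)) \<in> calderon \<longrightarrow>
    jet_le n (\<lambda>z. cscale (\<psi> z) (f z)) K \<longrightarrow>
    jet_le n f (C * (\<Sum>l<n. norm (taylor_coeff l \<phi>)) * K)"
proof -
  from jet_multiplier[of n] obtain C where C: "C \<ge> 0" and *: "\<And>f a. f \<in> calderon \<Longrightarrow> \<exists>g\<in>calderon.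
    calderon_norm g \<le> C * (\<Sum>l<n. norm (a l)) * calderon_norm f \<and>
    (\<forall>r<n. \<forall>j. taylor_coeff r (\<lambda>z. apply_bcontfun (g z) j)
      = (\<Sum>i\<le>r. a i * taylor_coeff (r - i) (\<lambda>z. apply_bcontfun (f z) j)))"
    by blast
  show ?thesis
  proof (intro exI[of _ C] conjI ballI allI impI C)
    fix f :: "complex \<Rightarrow> ell_infty" and \<psi> \<phi> :: "complex \<Rightarrow> complex" and K :: real
    let ?F = "\<lambda>z. cscale (\<psi> z) (f z)"
    assume f: "f \<in> calderon" and \<psi>: "\<psi> holomorphic_on strip" and \<phi>: "\<phi> holomorphic_on strip"
      and inv: "\<forall>z. \<phi> z * \<psi> z = 1" and F: "?F \<in> calderon" and K: "jet_le n ?F K"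
    obtain F' where F': "F' \<in> calderon" "calderon_norm F' \<le> K" "taylor_tuple n F' = taylor_tuple n ?F"
      using K unfolding jet_le_def by blast
    obtain g where g: "g \<in> calderon"
      "calderon_norm g \<le> C * (\<Sum>l<n. norm (taylor_coeff l \<phi>)) * calderon_norm F'"
      and tg: "\<And>r j. r < n \<Longrightarrow> taylor_coeff r (\<lambda>z. apply_bcontfun (g z) j)
      = (\<Sum>i\<le>r. taylor_coeff i \<phi> * taylor_coeff (r - i) (\<lambda>z. apply_bcontfun (F' z) j))"
      using *[OF F'(1), of "\<lambda>l. taylor_coeff l \<phi>"] by blast
    have "taylor_tuple n g = taylor_tuple n f"
      unfolding taylor_tuple_eq_iff[OF g(1) f]
    proof (intro allI impI)
      fix r j assume "r < n"
      then have "taylor_coeff r (\<lambda>z. apply_bcontfun (g z) j)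
          = (\<Sum>i\<le>r. taylor_coeff i \<phi> * taylor_coeff (r - i) (\<lambda>z. apply_bcontfun (?F z) j))"
        using F'(3)[unfolded taylor_tuple_eq_iff[OF F'(1) F]] by (simp add: tg)
      also have "\<dots> = taylor_coeff r (\<lambda>z. \<phi> z * apply_bcontfun (?F z) j)"
        by (rule taylor_coeff_mult[symmetric, OF \<phi> calderonD(1)[OF F]])
      also have "(\<lambda>z. \<phi> z * apply_bcontfun (?F z) j) = (\<lambda>z. apply_bcontfun (f z) j)"
        using inv by (simp flip: mult.assoc)
      finally show "taylor_coeff r (\<lambda>z. apply_bcontfun (g z) j) = taylor_coeff r (\<lambda>z. apply_bcontfun (f z) j)" .
    qed
    moreover have "calderon_norm g \<le> C * (\<Sum>l<n. norm (taylor_coeff l \<phi>)) * K"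
      using C F' by (intro order_trans[OF g(2)] mult_left_mono) (auto intro!: mult_nonneg_nonneg sum_nonneg)
    ultimately show "jet_le n f (C * (\<Sum>l<n. norm (taylor_coeff l \<phi>)) * K)"
      unfolding jet_le_def using g(1) by blast
  qed
qed

text \<open>Multiplying by \<open>exp (c (z - 1/2))\<close> balances the two edges; undoing it costs only a
  power of \<open>\<bar>c\<bar>\<close>.\<close>

lemma jet_le_rescale:
  "\<exists>C\<ge>0. \<forall>f\<in>calderon. \<forall>c A. (\<forall>t::real. exp (- c / 2) * norm (f (\<i> * t)) \<le> A) \<longrightarrow>
    (\<forall>t::real. exp (c / 2) * norm_1 (f (1 + \<i> * t)) \<le> A) \<longrightarrow>
    jet_le n f (C * (1 + \<bar>c\<bar>) ^ (n - 1) * A)"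
proof -
  from jet_le_divide[of n] obtain C where C: "C \<ge> 0" and *: "\<And>f \<psi> \<phi> K. f \<in> calderon \<Longrightarrow>
    \<psi> holomorphic_on strip \<Longrightarrow> \<phi> holomorphic_on strip \<Longrightarrow>
    (\<forall>z. \<phi> z * \<psi> z = 1) \<Longrightarrow> (\<lambda>z. cscale (\<psi> z) (f z)) \<in> calderon \<Longrightarrow>
    jet_le n (\<lambda>z. cscale (\<psi> z) (f z)) K \<Longrightarrow>
    jet_le n f (C * (\<Sum>l<n. norm (taylor_coeff l \<phi>)) * K)"
    by blast
  show ?thesis
  proof (intro exI[of _ "C * n"] conjI ballI allI impI)
    show "0 \<le> C * real n" using C by simp
    fix f :: "complex \<Rightarrow> ell_infty" and c A :: real
    assume f: "f \<in> calderon" and 0: "\<forall>t::real. exp (- c / 2) * norm (f (\<i> * t)) \<le> A"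
      and 1: "\<forall>t::real. exp (c / 2) * norm_1 (f (1 + \<i> * t)) \<le> A"
    have A: "0 \<le> A" using 0 by (meson exp_ge_zero mult_nonneg_nonneg norm_ge_zero order_trans)
    let ?\<psi> = "\<lambda>z. exp (complex_of_real c * (z - 1/2))"
    let ?\<phi> = "\<lambda>z. exp (complex_of_real (- c) * (z - 1/2))"
    have n\<psi>: "norm (?\<psi> z) = exp (c * (Re z - 1/2))" for z by simp
    \<comment> \<open>This crude bound serves membership in \<open>calderon\<close>; the norm is
      estimated from the two edges afterwards.\<close>
    have bd: "norm (?\<psi> z) \<le> exp \<bar>c\<bar>" if "z \<in> closure strip" for z
    proof -
      have "0 \<le> Re z" "Re z \<le> 1" using that by (auto simp: closure_strip)
      then have "\<bar>Re z - 1/2\<bar> \<le> 1" by linarith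
      then have "\<bar>c\<bar> * \<bar>Re z - 1/2\<bar> \<le> \<bar>c\<bar> * 1"
        by (intro mult_left_mono) auto
      then show ?thesis unfolding n\<psi> by (simp add: abs_mult[symmetric])
    qed
    have F: "(\<lambda>z. cscale (?\<psi> z) (f z)) \<in> calderon"
      by (rule calderon_mult[OF f _ bd]) (auto intro!: holomorphic_intros)
    have K: "calderon_norm (\<lambda>z. cscale (?\<psi> z) (f z)) \<le> A"
    proof (rule calderon_norm_leI)
      show "norm (cscale (?\<psi> (\<i> * complex_of_real t)) (f (\<i> * complex_of_real t))) \<le> A" for t
        using 0 norm_cscale_le[of "?\<psi> (\<i> * complex_of_real t)" "f (\<i> * complex_of_real t)"]
        unfolding n\<psi> by (auto intro: order_trans)
      show "norm_1 (cscale (?\<psi> (1 + \<i> * complex_of_real t)) (f (1 + \<i> * complex_of_real t))) \<le> A" for t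
        using 1 unfolding ell_1_cscale(2)[OF calderonD(4)[OF f]] n\<psi> by simp
    qed
    \<comment> \<open>The base \<open>1 + \<bar>c\<bar>\<close> is at least \<open>1\<close>, so the
      top power dominates all orders below \<open>n\<close>.\<close>
    have le: "norm (taylor_coeff l ?\<phi>) \<le> (1 + \<bar>c\<bar>) ^ (n - 1)" if "l < n" for l
    proof -
      have "norm (taylor_coeff l ?\<phi>) = \<bar>c\<bar> ^ l / fact l"
        unfolding taylor_coeff_exp by (simp add: norm_divide norm_power)
      also have "\<dots> \<le> \<bar>c\<bar> ^ l"
        by (simp add: divide_le_eq mult_le_cancel_left1)
      also have "\<dots> \<le> (1 + \<bar>c\<bar>) ^ l" by (intro power_mono) auto
      also have "\<dots> \<le> (1 + \<bar>c\<bar>) ^ (n - 1)" using that by (intro power_increasing) auto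
      finally show ?thesis .
    qed
    have "(\<Sum>l<n. norm (taylor_coeff l ?\<phi>)) \<le> n * (1 + \<bar>c\<bar>) ^ (n - 1)"
      using sum_mono[of "{..<n}" "\<lambda>l. norm (taylor_coeff l ?\<phi>)" "\<lambda>_. (1 + \<bar>c\<bar>) ^ (n - 1)"] le by simp
    then have "C * (\<Sum>l<n. norm (taylor_coeff l ?\<phi>)) * A \<le> C * (n * (1 + \<bar>c\<bar>) ^ (n - 1)) * A"
      using C A by (intro mult_right_mono mult_left_mono) auto
    moreover have "jet_le n f (C * (\<Sum>l<n. norm (taylor_coeff l ?\<phi>)) * A)"
      by (rule *[OF f _ _ _ F jet_le_mono[OF jet_le_refl[OF F] K]]) (auto intro!: holomorphic_intros simp flip: exp_add)
    ultimately show "jet_le n f (C * real n * (1 + \<bar>c\<bar>) ^ (n - 1) * A)"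
      by (auto intro: jet_le_mono simp: mult.assoc)
  qed
qed

section \<open>Tails, heads and disjoint sums\<close>

lemma norm_1_tail:
  assumes "x \<in> ell_1" "\<delta> > 0"
  shows "\<forall>\<^sub>F q in sequentially. norm_1 (trunc {q..} x) \<le> \<delta>"
proof -
  have s: "summable (\<lambda>i. norm (apply_bcontfun x i))"
    using assms by (simp add: ell_1_def)
  obtain N where N: "\<And>q. q \<ge> N \<Longrightarrow> norm (\<Sum>i. norm (apply_bcontfun x (i + q))) < \<delta>"
    using suminf_exist_split[OF assms(2) s] by blast
  have "norm_1 (trunc {q..} x) \<le> \<delta>" if "q \<ge> N" for q
  proof -
    have "norm_1 (trunc {q..} x) = (\<Sum>i. norm (apply_bcontfun (trunc {q..} x) (i + q)))
        + (\<Sum>i<q. norm (apply_bcontfun (trunc {q..} x) i))"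
      unfolding norm_1_def using ell_1_trunc(1)[OF assms(1), of "{q..}"]
      by (intro suminf_split_initial_segment) (simp add: ell_1_def)
    also have "\<dots> = (\<Sum>i. norm (apply_bcontfun x (i + q)))" by simp
    finally show ?thesis using N[OF that] by simp
  qed
  then show ?thesis unfolding eventually_sequentially by blast
qed

lemma trunc_diff: "trunc A (x - y) = trunc A x - trunc A y"
  by (rule bcontfun_eqI) simp

text \<open>Near \<open>x\<close> the edge values stay within \<open>\<delta> / 2\<close> of the
  value at \<open>x\<close> in the \<open>ell_1\<close> norm, so a tail estimate at one point covers
  a neighbourhood. Bolzano's bisection principle extends it to the compact interval.\<close>

lemma calderon_tail_compact:
  assumes f: "f \<in> calderon" and "\<delta> > 0" "a \<le> b"
  shows "\<forall>\<^sub>F q in sequentially. \<forall>t\<in>{a..b}. norm_1 (trunc {q..} (f (1 + \<i> * complex_of_real t))) \<le> \<delta>"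
  using \<open>a \<le> b\<close>
proof (induction rule: Bolzano)
  case (trans a b c)
  from trans(1,2) show ?case
  proof eventually_elim
    case (elim q)
    then show ?case by (metis atLeastAtMost_iff linear)
  qed
next
  case (local x)
  let ?f = "\<lambda>t::real. f (1 + \<i> * t)"
  note F = calderonD[OF f]
  have "\<forall>\<^sub>F s in at x. norm_1 (?f s - ?f x) < \<delta> / 2"
    using order_tendstoD(2)[OF F(5)[of x], of "\<delta> / 2"] \<open>\<delta> > 0\<close> by simp
  then obtain d where d: "d > 0" "\<And>s. s \<noteq> x \<Longrightarrow> dist s x < d \<Longrightarrow> norm_1 (?f s - ?f x) < \<delta> / 2"
    unfolding eventually_at by blast
  \<comment> \<open>The limit at \<open>x\<close> says nothing about \<open>s = x\<close>, where the
    difference is \<open>0\<close>.\<close>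
  have d': "norm_1 (?f s - ?f x) \<le> \<delta> / 2" if "dist s x < d" for s
    using d(2)[of s] that \<open>\<delta> > 0\<close> by (cases "s = x") auto
  have "\<forall>\<^sub>F q in sequentially. \<forall>t\<in>{a..b}. norm_1 (trunc {q..} (?f t)) \<le> \<delta>"
    if "a \<le> x" "x \<le> b" "b - a < d" for a b
    using norm_1_tail[OF F(4) half_gt_zero[OF \<open>\<delta> > 0\<close>], of x]
  proof eventually_elim
    case (elim q)
    show ?case
    proof
      fix t assume "t \<in> {a..b}"
      then have "dist t x < d" using that by (auto simp: dist_real_def)
      have m: "?f t - ?f x \<in> ell_1" "?f x \<in> ell_1" by (intro ell_1_diff F)+
      have eq: "trunc {q..} (?f t) = trunc {q..} (?f t - ?f x) + trunc {q..} (?f x)"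
        by (simp add: trunc_diff)
      have "norm_1 (trunc {q..} (?f t)) \<le> norm_1 (trunc {q..} (?f t - ?f x)) + norm_1 (trunc {q..} (?f x))"
        unfolding eq by (intro ell_1_add ell_1_trunc m)
      also have "\<dots> \<le> norm_1 (?f t - ?f x) + norm_1 (trunc {q..} (?f x))"
        by (intro add_right_mono ell_1_trunc m)
      also have "\<dots> \<le> \<delta> / 2 + \<delta> / 2"
        by (intro add_mono d' elim \<open>dist t x < d\<close>)
      finally show "norm_1 (trunc {q..} (?f t)) \<le> \<delta>" by simp
    qed
  qed
  then show ?case using d(1) by blast
qed

lemma trunc_cscale: "trunc A (cscale c x) = cscale c (trunc A x)"
  by (rule bcontfun_eqI) simp

text \<open>The whole edge is not compact. On it the Gaussian has modulus
  \<open>exp (1/4 - t\<^sup>2)\<close>, which makes all values outside \<open>{-R..R}\<close> small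
  at once; the interval itself is left to \<open>calderon_tail_compact\<close>.\<close>

lemma calderon_gauss_tail:
  assumes f: "f \<in> calderon" and "\<delta> > 0"
  shows "\<forall>\<^sub>F q in sequentially. \<forall>t::real.
    norm_1 (trunc {q..} (cscale (exp ((1 + \<i> * t - 1/2)\<^sup>2)) (f (1 + \<i> * t)))) \<le> \<delta>"
proof -
  let ?f = "\<lambda>t::real. f (1 + \<i> * t)"
  note F = calderonD[OF f] calderon_norm_ge[OF f]
  have "((\<lambda>R::real. exp (1/4 - R\<^sup>2)) \<longlongrightarrow> 0) at_top"
    by real_asymp
  then have "((\<lambda>R::real. exp (1/4 - R\<^sup>2) * calderon_norm f) \<longlongrightarrow> 0) at_top"
    by (rule tendsto_mult_left_zero)
  then have "\<forall>\<^sub>F R in at_top. exp (1/4 - R\<^sup>2) * calderon_norm f < \<delta>"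
    using order_tendstoD(2) \<open>\<delta> > 0\<close> by blast
  then have "\<forall>\<^sub>F R in at_top. exp (1/4 - R\<^sup>2) * calderon_norm f < \<delta> \<and> R \<ge> 0"
    using eventually_ge_at_top[of 0] by eventually_elim simp
  then obtain R where R: "exp (1/4 - R\<^sup>2) * calderon_norm f < \<delta>" "R \<ge> 0"
    using eventually_happens'[OF trivial_limit_at_top_linorder] by blast
  have ne: "norm (exp ((1 + \<i> * t - 1/2)\<^sup>2)) = exp (1/4 - t\<^sup>2)" for t :: real
    unfolding norm_exp_gauss by (simp add: power2_eq_square)
  \<comment> \<open>The divisor \<open>exp (1/4)\<close> is the largest modulus of the Gaussian on
    the right edge.\<close>
  have "\<forall>\<^sub>F q in sequentially. \<forall>t\<in>{-R..R}. norm_1 (trunc {q..} (?f t)) \<le> \<delta> / exp (1/4)"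
    using R \<open>\<delta> > 0\<close> by (intro calderon_tail_compact[OF f]) auto
  then show ?thesis
  proof eventually_elim
    case (elim q)
    show ?case
    proof
      fix t :: real
      have n: "norm_1 (trunc {q..} (cscale (exp ((1 + \<i> * t - 1/2)\<^sup>2)) (?f t)))
          = exp (1/4 - t\<^sup>2) * norm_1 (trunc {q..} (?f t))"
        unfolding trunc_cscale ell_1_cscale(2)[OF ell_1_trunc(1)[OF F(4)]] ne ..
      show "norm_1 (trunc {q..} (cscale (exp ((1 + \<i> * t - 1/2)\<^sup>2)) (?f t))) \<le> \<delta>"
      proof (cases "t \<in> {-R..R}")
        case True
        then have "exp (1/4 - t\<^sup>2) * norm_1 (trunc {q..} (?f t)) \<le> exp (1/4) * (\<delta> / exp (1/4))"
          using elim norm_1_nonneg[OF ell_1_trunc(1)[OF F(4)]] by (intro mult_mono) auto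
        then show ?thesis unfolding n by simp
      next
        case False
        then have "R\<^sup>2 \<le> t\<^sup>2" using R(2) by (auto simp: abs_le_square_iff[symmetric])
        then have "exp (1/4 - t\<^sup>2) * norm_1 (trunc {q..} (?f t)) \<le> exp (1/4 - R\<^sup>2) * calderon_norm f"
          using norm_1_nonneg[OF ell_1_trunc(1)[OF F(4)]]
            order_trans[OF ell_1_trunc(2)[OF F(4)] F(7)] by (intro mult_mono) auto
        then show ?thesis unfolding n using R(1) by simp
      qed
    qed
  qed
qed

lemma power_times_exp_tendsto_0: "((\<lambda>c::real. (1 + c) ^ k * exp (- c / 2)) \<longlongrightarrow> 0) at_top"
proof -
  have "filterlim (\<lambda>c::real. (1 + c) / 2) at_top at_top"
    by real_asymp
  from filterlim_compose[OF tendsto_power_div_exp_0 this, of k]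
  have "((\<lambda>c::real. ((1 + c) / 2) ^ k / exp ((1 + c) / 2) * (2 ^ k * exp (1 / 2))) \<longlongrightarrow> 0) at_top"
    by (rule tendsto_mult_left_zero)
  moreover have "((1 + c) / 2) ^ k / exp ((1 + c) / 2) * (2 ^ k * exp (1 / 2)) = (1 + c) ^ k * exp (- c / 2)"
    for c :: real
  proof -
    have "exp (1 / 2) / exp ((1 + c) / 2) = exp (- c / 2)"
      unfolding exp_diff[symmetric] by (simp add: field_simps)
    moreover have "((1 + c) / 2) ^ k * 2 ^ k = (1 + c) ^ k"
      by (simp add: power_divide)
    ultimately show ?thesis
      by (metis (no_types, lifting) mult.assoc mult.commute times_divide_eq_right)
  qed
  ultimately show ?thesis by (simp only:)
qed

text \<open>On the left edge the tails are merely known to be bounded; on the right edge they become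
  small after Gaussian damping. Once they are below \<open>exp (- c) * K\<close> there, rescaling by
  \<open>c\<close> brings both edges to \<open>exp (- c / 2) * K\<close> at the price of
  \<open>(1 + c) ^ (n - 1)\<close>, which the exponential absorbs for large \<open>c\<close>. The
  Gaussian is finally divided out through its jet.\<close>

lemma jet_le_tail:
  assumes f: "f \<in> calderon" and "\<eta> > 0"
  shows "\<forall>\<^sub>F q in sequentially. jet_le n (\<lambda>z. trunc {q..} (f z)) \<eta>"
proof -
  let ?E = "\<lambda>z. exp ((z - 1/2)\<^sup>2) :: complex" and ?D = "\<lambda>z. exp (- ((z - 1/2)\<^sup>2)) :: complex"
  from jet_le_divide[of n] obtain C1 where C1: "C1 \<ge> 0" and 1: "\<And>f \<psi> \<phi> K. f \<in> calderon \<Longrightarrow>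
    \<psi> holomorphic_on strip \<Longrightarrow> \<phi> holomorphic_on strip \<Longrightarrow>
    (\<forall>z. \<phi> z * \<psi> z = 1) \<Longrightarrow> (\<lambda>z. cscale (\<psi> z) (f z)) \<in> calderon \<Longrightarrow>
    jet_le n (\<lambda>z. cscale (\<psi> z) (f z)) K \<Longrightarrow>
    jet_le n f (C1 * (\<Sum>l<n. norm (taylor_coeff l \<phi>)) * K)"
    by blast
  from jet_le_rescale[of n] obtain C2 where C2: "C2 \<ge> 0" and 2: "\<And>f c A. f \<in> calderon \<Longrightarrow>
    (\<forall>t::real. exp (- c / 2) * norm (f (\<i> * t)) \<le> A) \<Longrightarrow>
    (\<forall>t::real. exp (c / 2) * norm_1 (f (1 + \<i> * t)) \<le> A) \<Longrightarrow>
    jet_le n f (C2 * (1 + \<bar>c\<bar>) ^ (n - 1) * A)"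
    by blast
  define g where "g = (\<lambda>z. cscale (?E z) (f z))"
  have E: "norm (?E z) \<le> exp 1" if "z \<in> closure strip" for z
    using power_times_gauss_bounded[OF that, of 0] by simp
  have Eh: "?E holomorphic_on A" "?D holomorphic_on A" for A
    by (intro holomorphic_intros)+
  have mem: "(\<lambda>z. cscale (?E z) (h z)) \<in> calderon" if "h \<in> calderon" for h
    by (rule calderon_mult[OF that Eh(1) E])
  have g: "g \<in> calderon" unfolding g_def by (rule mem[OF f])
  \<comment> \<open>The summand \<open>1\<close> keeps \<open>K\<close> positive, so that
    \<open>exp (- c) * K\<close> is an admissible tail tolerance.\<close>
  define K where "K = calderon_norm g + 1"
  have K: "K > 0" using calderon_norm_nonneg[OF g] by (simp add: K_def)
  define S where "S = C1 * (\<Sum>l<n. norm (taylor_coeff l ?D))"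
  have S: "S \<ge> 0" unfolding S_def using C1 by (intro mult_nonneg_nonneg sum_nonneg) auto
  have "((\<lambda>c. (1 + c) ^ (n - 1) * exp (- c / 2) * (S * C2 * K)) \<longlongrightarrow> 0) at_top"
    by (intro tendsto_mult_left_zero power_times_exp_tendsto_0)
  then have "((\<lambda>c::real. S * (C2 * (1 + c) ^ (n - 1) * (exp (- c / 2) * K))) \<longlongrightarrow> 0) at_top"
    by (simp only: mult_ac)
  then have "\<forall>\<^sub>F c in at_top. S * (C2 * (1 + c) ^ (n - 1) * (exp (- c / 2) * K)) < \<eta>"
    using order_tendstoD(2) \<open>\<eta> > 0\<close> by blast
  then have "\<forall>\<^sub>F c in at_top. S * (C2 * (1 + c) ^ (n - 1) * (exp (- c / 2) * K)) < \<eta> \<and> c \<ge> 0"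
    using eventually_ge_at_top[of 0] by eventually_elim simp
  then obtain c where c: "S * (C2 * (1 + c) ^ (n - 1) * (exp (- c / 2) * K)) < \<eta>" "c \<ge> 0"
    using eventually_happens'[OF trivial_limit_at_top_linorder] by blast
  have "exp (- c) * K > 0" using K by simp
  from calderon_gauss_tail[OF f this] show ?thesis
  proof eventually_elim
    case (elim q)
    have tf: "(\<lambda>z. trunc {q..} (f z)) \<in> calderon" and tg: "(\<lambda>z. trunc {q..} (g z)) \<in> calderon"
      by (intro calderon_trunc f g)+
    have "jet_le n (\<lambda>z. trunc {q..} (g z)) (C2 * (1 + \<bar>c\<bar>) ^ (n - 1) * (exp (- c / 2) * K))"
    proof (rule 2[OF tg]; intro allI)
      fix t :: real
      have "norm (trunc {q..} (g (\<i> * complex_of_real t))) \<le> K"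
        using order_trans[OF norm_trunc_le calderon_norm_ge(1)[OF g]] by (auto simp: K_def intro: add_increasing2)
      then show "exp (- c / 2) * norm (trunc {q..} (g (\<i> * complex_of_real t))) \<le> exp (- c / 2) * K"
        by (intro mult_left_mono) auto
      have "exp (c / 2) * norm_1 (trunc {q..} (g (1 + \<i> * complex_of_real t))) \<le> exp (c / 2) * (exp (- c) * K)"
        using elim by (intro mult_left_mono) (auto simp: g_def)
      also have "exp (c / 2) * (exp (- c) * K) = exp (c / 2 + - c) * K"
        by (simp only: exp_add mult.assoc)
      also have "c / 2 + - c = - c / 2" by simp
      finally show "exp (c / 2) * norm_1 (trunc {q..} (g (1 + \<i> * complex_of_real t))) \<le> exp (- c / 2) * K" .
    qed
    then have "jet_le n (\<lambda>z. cscale (?E z) (trunc {q..} (f z))) (C2 * (1 + c) ^ (n - 1) * (exp (- c / 2) * K))"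
      using c(2) by (simp add: g_def trunc_cscale)
    from 1[OF tf Eh _ mem[OF tf] this]
    have "jet_le n (\<lambda>z. trunc {q..} (f z)) (S * (C2 * (1 + c) ^ (n - 1) * (exp (- c / 2) * K)))"
      by (simp add: S_def flip: exp_add)
    then show ?case
      using c(1) by (auto intro: jet_le_mono)
  qed
qed

text \<open>A jet living on one coordinate is a scalar jet times \<open>unit_seq j\<close>, so
  \<open>jet_multiplier\<close>, applied to a constant function, bounds it by its coefficients. The
  \<open>p\<close> coordinates are added by the triangle inequality.\<close>

lemma jet_le_head:
  "\<exists>C\<ge>0. \<forall>f\<in>calderon. \<forall>p \<epsilon>.
    (\<forall>l<n. \<forall>j<p. norm (taylor_coeff l (\<lambda>z. apply_bcontfun (f z) j)) \<le> \<epsilon>) \<longrightarrow>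
    jet_le n (\<lambda>z. trunc {..<p} (f z)) (C * p * \<epsilon>)"
proof -
  from jet_multiplier[of n] obtain C where C: "C \<ge> 0" and *: "\<And>f a. f \<in> calderon \<Longrightarrow> \<exists>g\<in>calderon.
    calderon_norm g \<le> C * (\<Sum>l<n. norm (a l)) * calderon_norm f \<and>
    (\<forall>r<n. \<forall>j. taylor_coeff r (\<lambda>z. apply_bcontfun (g z) j)
      = (\<Sum>i\<le>r. a i * taylor_coeff (r - i) (\<lambda>z. apply_bcontfun (f z) j)))"
    by blast
  show ?thesis
  proof (intro exI[of _ "C * n"] conjI ballI allI impI)
    show "0 \<le> C * real n" using C by simp
    fix f :: "complex \<Rightarrow> ell_infty" and p :: nat and \<epsilon> :: real
    assume f: "f \<in> calderon"
      and le: "\<forall>l<n. \<forall>j<p. norm (taylor_coeff l (\<lambda>z. apply_bcontfun (f z) j)) \<le> \<epsilon>"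
    have "jet_le n (\<lambda>z. trunc {j} (f z)) (C * n * \<epsilon>)" if "j < p" for j
    proof -
      let ?a = "\<lambda>l. taylor_coeff l (\<lambda>z. apply_bcontfun (f z) j)"
      have tf: "(\<lambda>z. trunc {j} (f z)) \<in> calderon" by (intro calderon_trunc f)
      obtain g where g: "g \<in> calderon"
        "calderon_norm g \<le> C * (\<Sum>l<n. norm (?a l)) * calderon_norm (\<lambda>_. unit_seq j)"
        and tg: "\<And>r i. r < n \<Longrightarrow> taylor_coeff r (\<lambda>z. apply_bcontfun (g z) i)
          = (\<Sum>l\<le>r. ?a l * taylor_coeff (r - l) (\<lambda>z. apply_bcontfun (unit_seq j) i))"
        using *[OF calderon_unit_seq(1), of ?a j] by blast
      have "taylor_tuple n g = taylor_tuple n (\<lambda>z. trunc {j} (f z))"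
        unfolding taylor_tuple_eq_iff[OF g(1) tf]
      proof (intro allI impI)
        fix r i assume "r < n"
        then have "taylor_coeff r (\<lambda>z. apply_bcontfun (g z) i) = (\<Sum>l\<le>r. if l = r then (if i = j then ?a l else 0) else 0)"
          unfolding tg[OF \<open>r < n\<close>] taylor_coeff_const by (intro sum.cong) auto
        then show "taylor_coeff r (\<lambda>z. apply_bcontfun (g z) i) = taylor_coeff r (\<lambda>z. apply_bcontfun (trunc {j} (f z)) i)"
          by (auto simp: taylor_coeff_const)
      qed
      moreover have "calderon_norm g \<le> C * n * \<epsilon>"
      proof -
        have sum_le: "(\<Sum>l<n. norm (?a l)) \<le> n * \<epsilon>"
          using sum_mono[of "{..<n}" "\<lambda>l. norm (?a l)" "\<lambda>_. \<epsilon>"] le that by simp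
        have "calderon_norm g \<le> C * (\<Sum>l<n. norm (?a l)) * 1"
          using C by (intro order_trans[OF g(2)] mult_left_mono calderon_unit_seq) (auto intro!: mult_nonneg_nonneg sum_nonneg)
        also have "\<dots> \<le> C * (n * \<epsilon>)"
          using sum_le C by (simp add: mult_left_mono)
        finally show ?thesis by (simp add: mult.assoc)
      qed
      ultimately show ?thesis unfolding jet_le_def using g(1) by blast
    qed
    then have "jet_le n (\<lambda>z. \<Sum>j<p. trunc {j} (f z)) (\<Sum>j<p. C * n * \<epsilon>)"
      by (intro jet_le_sum calderon_trunc f) auto
    moreover have "(\<Sum>j<p. trunc {j} (f z)) = trunc {..<p} (f z)" for z
      by (rule bcontfun_eqI) (simp add: apply_bcontfun_sum)
    ultimately show "jet_le n (\<lambda>z. trunc {..<p} (f z)) (C * real n * real p * \<epsilon>)"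
      by (simp add: mult_ac)
  qed
qed

text \<open>Disjointness keeps the supremum norm on the left edge at most \<open>K\<close>, while
  \<open>norm_1\<close> on the right edge is at most \<open>m * K\<close>. Rescaling with
  \<open>c = - ln m\<close> balances both at \<open>sqrt m * K\<close> and costs a power of
  \<open>1 + ln m\<close>.\<close>

lemma jet_le_disjoint_sum:
  "\<exists>C\<ge>0. \<forall>m\<ge>1. \<forall>f A K. (\<forall>i<m. f i \<in> calderon \<and> calderon_norm (f i) \<le> K) \<longrightarrow>
    disjoint_family_on A {..<m} \<longrightarrow>
    jet_le n (\<lambda>z. \<Sum>i<m. trunc (A i) (f i z)) (C * (1 + ln (real m)) ^ (n - 1) * (sqrt m * K))"
proof -
  from jet_le_rescale[of n] obtain C where C: "C \<ge> 0" and *: "\<And>f c A. f \<in> calderon \<Longrightarrow>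
    (\<forall>t::real. exp (- c / 2) * norm (f (\<i> * t)) \<le> A) \<Longrightarrow>
    (\<forall>t::real. exp (c / 2) * norm_1 (f (1 + \<i> * t)) \<le> A) \<Longrightarrow>
    jet_le n f (C * (1 + \<bar>c\<bar>) ^ (n - 1) * A)"
    by blast
  show ?thesis
  proof (intro exI[of _ C] conjI allI impI C)
    fix m :: nat and f :: "nat \<Rightarrow> complex \<Rightarrow> ell_infty" and A :: "nat \<Rightarrow> nat set" and K :: real
    assume m: "1 \<le> m" and f: "\<forall>i<m. f i \<in> calderon \<and> calderon_norm (f i) \<le> K"
      and A: "disjoint_family_on A {..<m}"
    let ?F = "\<lambda>z. \<Sum>i<m. trunc (A i) (f i z)"
    have "f 0 \<in> calderon" "calderon_norm (f 0) \<le> K" using f m by auto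
    then have K: "0 \<le> K" using calderon_norm_nonneg order_trans by blast
    have F: "?F \<in> calderon" using f by (intro calderon_sum calderon_trunc) auto
    have "calderon_norm ?F \<le> (\<Sum>i<m. calderon_norm (\<lambda>z. trunc (A i) (f i z)))"
      using f by (intro calderon_sum calderon_trunc) auto
    also have "\<dots> \<le> (\<Sum>i<m. K)"
      using f by (intro sum_mono order_trans[OF calderon_trunc(2)]) auto
    finally have mK: "calderon_norm ?F \<le> m * K" by simp
    have sup: "norm (?F (\<i> * complex_of_real t)) \<le> K" for t
    proof (rule norm_bound)
      fix j
      show "norm (apply_bcontfun (?F (\<i> * complex_of_real t)) j) \<le> K"
      proof (cases "\<exists>i<m. j \<in> A i")
        case True
        then obtain i where i: "i < m" "j \<in> A i" by blast
        have "apply_bcontfun (?F (\<i> * complex_of_real t)) j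
            = (\<Sum>i'<m. if i' = i then apply_bcontfun (f i (\<i> * complex_of_real t)) j else 0)"
          unfolding apply_bcontfun_sum apply_trunc
          using i A by (intro sum.cong) (auto simp: disjoint_family_on_def)
        also have "\<dots> = apply_bcontfun (f i (\<i> * complex_of_real t)) j" using i by simp
        also have "norm \<dots> \<le> K"
          using f i by (intro order_trans[OF norm_bounded] order_trans[OF calderon_norm_ge(1)]) auto
        finally show ?thesis .
      next
        case False
        then have "apply_bcontfun (?F (\<i> * complex_of_real t)) j = 0"
          unfolding apply_bcontfun_sum apply_trunc by (intro sum.neutral) auto
        then show ?thesis using K by simp
      qed
    qed
    have "exp (ln (real m) / 2) = sqrt m"
      using m by (simp flip: ln_sqrt)
    then have e: "exp (- (- ln (real m)) / 2) = sqrt m" "exp (- ln (real m) / 2) = 1 / sqrt m"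
      by (simp_all add: exp_minus inverse_eq_divide)
    have "jet_le n ?F (C * (1 + \<bar>- ln (real m)\<bar>) ^ (n - 1) * (sqrt m * K))"
    proof (rule *[OF F]; unfold e; intro allI)
      fix t
      show "sqrt (real m) * norm (?F (\<i> * complex_of_real t)) \<le> sqrt (real m) * K"
        using sup by (intro mult_left_mono) auto
      have "1 / sqrt m * norm_1 (?F (1 + \<i> * complex_of_real t)) \<le> 1 / sqrt m * (m * K)"
        using order_trans[OF calderon_norm_ge(2)[OF F] mK] by (intro mult_left_mono) auto
      also have "\<dots> = sqrt m * K" using m by (simp add: field_simps)
      finally show "1 / sqrt m * norm_1 (?F (1 + \<i> * complex_of_real t)) \<le> sqrt m * K" .
    qed
    then show "jet_le n ?F (C * (1 + ln (real m)) ^ (n - 1) * (sqrt m * K))"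
      using m by simp
  qed
qed

section \<open>The gliding hump\<close>

text \<open>In the application \<open>H p s\<close> says that the head of term \<open>s\<close>
  below \<open>p\<close> is negligible, and \<open>T q s\<close> that its tail from \<open>q\<close>
  on is. Terms and cuts are chosen alternately by dependent choice. The gap \<open>2\<close> keeps
  the index pairs \<open>s i\<close>, \<open>Suc (s i)\<close> of the later differences
  disjoint.\<close>

lemma gliding_hump_selection:
  fixes H T :: "nat \<Rightarrow> nat \<Rightarrow> bool"
  assumes H: "\<And>p. \<forall>\<^sub>F s in sequentially. H p s" and T: "\<And>s. \<forall>\<^sub>F q in sequentially. T q s"
  shows "\<exists>s p. \<forall>i. s i + 2 \<le> s (Suc i) \<and> p i \<le> p (Suc i) \<and> H (p i) (s i) \<and> T (p (Suc i)) (s i)"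
proof -
  have "\<exists>x. \<forall>i. H (snd (x i)) (fst (x i)) \<and>
    (fst (x i) + 2 \<le> fst (x (Suc i)) \<and> snd (x i) \<le> snd (x (Suc i)) \<and> T (snd (x (Suc i))) (fst (x i)))"
  proof (rule dependent_nat_choice)
    obtain s where "H 0 s"
      using eventually_happens'[OF _ H[of 0]] by auto
    then show "\<exists>x. H (snd x) (fst x)" by auto
  next
    fix x :: "nat \<times> nat" assume "H (snd x) (fst x)"
    obtain p where p: "T p (fst x)" "snd x \<le> p"
      using eventually_happens'[OF _ eventually_conj[OF T[of "fst x"] eventually_ge_at_top[of "snd x"]]] by auto
    obtain s where s: "H p s" "fst x + 2 \<le> s"
      using eventually_happens'[OF _ eventually_conj[OF H[of p] eventually_ge_at_top[of "fst x + 2"]]] by auto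
    show "\<exists>y. H (snd y) (fst y) \<and> (fst x + 2 \<le> fst y \<and> snd x \<le> snd y \<and> T (snd y) (fst x))"
      using p s by (intro exI[of _ "(s, p)"]) simp
  qed
  then obtain x where "\<forall>i. H (snd (x i)) (fst (x i)) \<and>
    (fst (x i) + 2 \<le> fst (x (Suc i)) \<and> snd (x i) \<le> snd (x (Suc i)) \<and> T (snd (x (Suc i))) (fst (x i)))" ..
  then show ?thesis
    by (intro exI[of _ "\<lambda>i. fst (x i)"] exI[of _ "\<lambda>i. snd (x i)"]) auto
qed

text \<open>Each \<open>w i\<close> is cut at \<open>p i\<close> and \<open>p (Suc i)\<close>. The
  middle pieces are disjointly supported; the heads and the tails contribute at most
  \<open>1\<close> each. The resulting \<open>2\<close> can stand before the growth factor because
  that factor is at least \<open>1\<close>.\<close>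

lemma jet_le_hump_sum:
  "\<exists>C\<ge>0. \<forall>m\<ge>1. \<forall>w p K. (\<forall>i<m. w i \<in> calderon \<and> calderon_norm (w i) \<le> K) \<longrightarrow>
    (\<forall>i. p i \<le> p (Suc i)) \<longrightarrow>
    (\<forall>i<m. jet_le n (\<lambda>z. trunc {..<p i} (w i z)) (1 / m)) \<longrightarrow>
    (\<forall>i<m. jet_le n (\<lambda>z. trunc {p (Suc i)..} (w i z)) (1 / m)) \<longrightarrow>
    jet_le n (\<lambda>z. \<Sum>i<m. w i z) ((2 + C * K) * (1 + ln (real m)) ^ (n - 1) * sqrt m)"
proof -
  from jet_le_disjoint_sum[of n] obtain C where C: "C \<ge> 0" and *: "\<And>m f A K. m \<ge> 1 \<Longrightarrow>
    (\<forall>i<m. f i \<in> calderon \<and> calderon_norm (f i) \<le> K) \<Longrightarrow> disjoint_family_on A {..<m} \<Longrightarrow>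
    jet_le n (\<lambda>z. \<Sum>i<m. trunc (A i) (f i z)) (C * (1 + ln (real m)) ^ (n - 1) * (sqrt m * K))"
    by blast
  show ?thesis
  proof (intro exI[of _ C] conjI allI impI C)
    fix m :: nat and w :: "nat \<Rightarrow> complex \<Rightarrow> ell_infty" and p :: "nat \<Rightarrow> nat" and K :: real
    assume m: "1 \<le> m" and w: "\<forall>i<m. w i \<in> calderon \<and> calderon_norm (w i) \<le> K"
      and p: "\<forall>i. p i \<le> p (Suc i)"
      and head: "\<forall>i<m. jet_le n (\<lambda>z. trunc {..<p i} (w i z)) (1 / m)"
      and tail: "\<forall>i<m. jet_le n (\<lambda>z. trunc {p (Suc i)..} (w i z)) (1 / m)"
    have mono: "p i \<le> p j" if "i \<le> j" for i j
      using lift_Suc_mono_le[of p] p that by blast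
    let ?A = "\<lambda>i. {p i..<p (Suc i)}"
    have dis: "disjoint_family_on ?A {..<m}"
      unfolding disjoint_family_on_def
    proof (intro ballI impI)
      fix i j :: nat assume "i \<noteq> j"
      then consider "Suc i \<le> j" | "Suc j \<le> i" by linarith
      then show "?A i \<inter> ?A j = {}"
        by cases (use mono in fastforce)+
    qed
    let ?h = "\<lambda>z. \<Sum>i<m. trunc {..<p i} (w i z)" and ?t = "\<lambda>z. \<Sum>i<m. trunc {p (Suc i)..} (w i z)"
    let ?M = "\<lambda>z. \<Sum>i<m. trunc (?A i) (w i z)"
    have c: "?h \<in> calderon" "?t \<in> calderon" "?M \<in> calderon"
      using w by (auto intro!: calderon_sum calderon_trunc)
    have "jet_le n ?h (\<Sum>i<m. 1 / m)" "jet_le n ?t (\<Sum>i<m. 1 / m)"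
      by (rule jet_le_sum; use head tail w in \<open>auto intro!: calderon_trunc\<close>)+
    then have 1: "jet_le n ?h 1" "jet_le n ?t 1" using m by simp_all
    have 2: "jet_le n ?M (C * (1 + ln (real m)) ^ (n - 1) * (sqrt m * K))"
      using *[OF m w dis] .
    have "jet_le n (\<lambda>z. ?h z + ?t z + ?M z) (1 + 1 + C * (1 + ln (real m)) ^ (n - 1) * (sqrt m * K))"
      by (intro jet_le_add 1 2 c calderon_add)
    moreover have "?h z + ?t z + ?M z = (\<Sum>i<m. w i z)" for z
    proof -
      have "trunc {..<p i} x + trunc {p (Suc i)..} x + trunc (?A i) x = x" for i x
        using mono[of i "Suc i"] by (intro bcontfun_eqI) auto
      then show ?thesis by (simp flip: sum.distrib)
    qed
    moreover have "1 + 1 + C * (1 + ln (real m)) ^ (n - 1) * (sqrt m * K)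
        \<le> (2 + C * K) * (1 + ln (real m)) ^ (n - 1) * sqrt m"
    proof -
      have "1 * 1 \<le> (1 + ln (real m)) ^ (n - 1) * sqrt m"
        using m by (intro mult_mono) (auto intro!: one_le_power)
      then show ?thesis by (simp add: algebra_simps)
    qed
    ultimately show "jet_le n (\<lambda>z. \<Sum>i<m. w i z) ((2 + C * K) * (1 + ln (real m)) ^ (n - 1) * sqrt m)"
      by (auto intro: jet_le_mono)
  qed
qed

lemma jet_le_head_eventually:
  assumes w: "\<And>s. w s \<in> calderon" and "\<eta> > 0"
    and lim: "\<And>l j. l < n \<Longrightarrow> (\<lambda>s. taylor_coeff l (\<lambda>z. apply_bcontfun (w s z) j)) \<longlonglongrightarrow> 0"
  shows "\<forall>\<^sub>F s in sequentially. jet_le n (\<lambda>z. trunc {..<p} (w s z)) \<eta>"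
proof -
  from jet_le_head[of n] obtain C where C: "C \<ge> 0" and *: "\<And>f p \<epsilon>. f \<in> calderon \<Longrightarrow>
    (\<forall>l<n. \<forall>j<p. norm (taylor_coeff l (\<lambda>z. apply_bcontfun (f z) j)) \<le> \<epsilon>) \<Longrightarrow>
    jet_le n (\<lambda>z. trunc {..<p} (f z)) (C * p * \<epsilon>)"
    by blast
  \<comment> \<open>The summand \<open>1\<close> keeps the denominator positive even if
    \<open>C\<close> or \<open>p\<close> is \<open>0\<close>.\<close>
  define \<epsilon> where "\<epsilon> = \<eta> / (C * p + 1)"
  have pos: "C * p + 1 > 0" using C by (simp add: add_nonneg_pos)
  then have "\<epsilon> > 0" using \<open>\<eta> > 0\<close> by (simp add: \<epsilon>_def)
  have "\<forall>\<^sub>F s in sequentially. \<forall>l\<in>{..<n}. \<forall>j\<in>{..<p}. norm (taylor_coeff l (\<lambda>z. apply_bcontfun (w s z) j)) < \<epsilon>"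
    using order_tendstoD(2)[OF tendsto_norm_zero[OF lim] \<open>\<epsilon> > 0\<close>]
    by (intro eventually_ball_finite ballI) auto
  then show ?thesis
  proof eventually_elim
    case (elim s)
    have "jet_le n (\<lambda>z. trunc {..<p} (w s z)) (C * p * \<epsilon>)"
      using elim by (intro *[OF w]) (auto intro: less_imp_le)
    moreover have "C * p * \<epsilon> \<le> (C * p + 1) * \<epsilon>"
      using \<open>\<epsilon> > 0\<close> by (simp add: distrib_right)
    moreover have "(C * p + 1) * \<epsilon> = \<eta>" using pos by (simp add: \<epsilon>_def)
    ultimately show ?case using jet_le_mono by metis
  qed
qed

text \<open>The coefficients are bounded by Cauchy's estimates and indexed by a countable set, so a
  diagonal argument applies. The Boolean in the index selects \<open>u\<close> or \<open>v\<close>,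
  which makes one subsequence serve both families.\<close>

lemma coefficientwise_convergent_subsequence:
  fixes u v :: "nat \<Rightarrow> complex \<Rightarrow> ell_infty"
  assumes "\<And>i. u i \<in> calderon" "\<And>i. calderon_norm (u i) \<le> K"
    and "\<And>i. v i \<in> calderon" "\<And>i. calderon_norm (v i) \<le> K"
  shows "\<exists>r :: nat \<Rightarrow> nat. strict_mono r \<and>
    (\<forall>l<N. \<forall>j. convergent (\<lambda>i. taylor_coeff l (\<lambda>z. apply_bcontfun (u (r i) z) j)) \<and>
      convergent (\<lambda>i. taylor_coeff l (\<lambda>z. apply_bcontfun (v (r i) z) j)))"
proof -
  define F where "F = (\<lambda>i (b, l, j). taylor_coeff l (\<lambda>z. apply_bcontfun ((if b then u i else v i) z) j))"
  have K: "0 \<le> K" using calderon_norm_nonneg[OF assms(1)[of 0]] assms(2)[of 0] by linarith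
  have bnd: "norm (F i x) \<le> 4 ^ N * K" if "x \<in> UNIV \<times> {..<N} \<times> UNIV" for i x
  proof -
    obtain b l j where x: "x = (b, l, j)" "l < N" using \<open>x \<in> _\<close> by (cases x) auto
    have "norm (F i x) \<le> 4 ^ l * calderon_norm (if b then u i else v i)"
      unfolding F_def x prod.case using assms by (intro calderon_taylor_coeff_le) auto
    also have "\<dots> \<le> 4 ^ N * K"
      using assms x K by (intro mult_mono power_increasing) (auto simp: calderon_norm_nonneg)
    finally show ?thesis .
  qed
  have "\<exists>r :: nat \<Rightarrow> nat. strict_mono r \<and> (\<forall>x\<in>UNIV \<times> {..<N} \<times> UNIV. \<exists>l. (\<lambda>i. F (r i) x) \<longlonglongrightarrow> l)"
    by (rule function_convergent_subsequence[where S = "UNIV \<times> {..<N} \<times> UNIV" and f = F, OF countableI_type bnd])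
      (assumption, blast)
  then obtain r where r: "strict_mono (r :: nat \<Rightarrow> nat)"
    and lim: "\<And>x. x \<in> UNIV \<times> {..<N} \<times> UNIV \<Longrightarrow> \<exists>l. (\<lambda>i. F (r i) x) \<longlonglongrightarrow> l"
    by blast
  show ?thesis
  proof (intro exI[of _ r] conjI[OF r] allI impI)
    fix l j assume "l < N"
    then show "convergent (\<lambda>i. taylor_coeff l (\<lambda>z. apply_bcontfun (u (r i) z) j)) \<and>
      convergent (\<lambda>i. taylor_coeff l (\<lambda>z. apply_bcontfun (v (r i) z) j))"
      using lim[of "(True, l, j)"] lim[of "(False, l, j)"] by (auto simp: F_def convergent_def)
  qed
qed

text \<open>Successive differences along a coefficientwise convergent subsequence have coefficients
  tending to \<open>0\<close>, so their heads eventually become negligible; far tails of each single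
  difference are negligible by \<open>jet_le_tail\<close>. One selection handles both components.
  The indices depend on \<open>m\<close>, since the tolerance is \<open>1 / m\<close>, but
  \<open>C\<close> does not.\<close>

lemma sums_of_differences_upper:
  fixes u v :: "nat \<Rightarrow> complex \<Rightarrow> ell_infty"
  assumes u: "\<And>i. u i \<in> calderon" "\<And>i. calderon_norm (u i) \<le> K"
    and v: "\<And>i. v i \<in> calderon" "\<And>i. calderon_norm (v i) \<le> K"
  obtains C where "\<And>m. m \<ge> 1 \<Longrightarrow> \<exists>a b :: nat \<Rightarrow> nat. (\<forall>i. a i < b i \<and> b i < a (Suc i)) \<and>
    jet_le n (\<lambda>z. \<Sum>i<m. u (a i) z - u (b i) z) (C * (1 + ln (real m)) ^ (n - 1) * sqrt m) \<and>
    jet_le k (\<lambda>z. \<Sum>i<m. v (a i) z - v (b i) z) (C * (1 + ln (real m)) ^ (k - 1) * sqrt m)"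
proof -
  obtain r :: "nat \<Rightarrow> nat" where r: "strict_mono r"
    and convu: "\<And>l j. l < n + k \<Longrightarrow> convergent (\<lambda>i. taylor_coeff l (\<lambda>z. apply_bcontfun (u (r i) z) j))"
    and convv: "\<And>l j. l < n + k \<Longrightarrow> convergent (\<lambda>i. taylor_coeff l (\<lambda>z. apply_bcontfun (v (r i) z) j))"
    using coefficientwise_convergent_subsequence[where u = u and v = v and K = K and N = "n + k", OF u v]
    by blast
  define U where "U = (\<lambda>s z. u (r s) z - u (r (Suc s)) z)"
  define V where "V = (\<lambda>s z. v (r s) z - v (r (Suc s)) z)"
  have U: "U s \<in> calderon" "calderon_norm (U s) \<le> 2 * K" for s
    unfolding U_def
    using calderon_diff(1)[OF u(1) u(1)] order_trans[OF calderon_diff(2)[OF u(1) u(1)] add_mono[OF u(2) u(2)]]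
    by simp_all
  have V: "V s \<in> calderon" "calderon_norm (V s) \<le> 2 * K" for s
    unfolding V_def
    using calderon_diff(1)[OF v(1) v(1)] order_trans[OF calderon_diff(2)[OF v(1) v(1)] add_mono[OF v(2) v(2)]]
    by simp_all
  have diff_lim: "(\<lambda>i. x i - x (Suc i)) \<longlonglongrightarrow> 0" if "convergent x" for x :: "nat \<Rightarrow> complex"
  proof -
    obtain l where "x \<longlonglongrightarrow> l" using \<open>convergent x\<close> by (auto simp: convergent_def)
    from tendsto_diff[OF this LIMSEQ_Suc[OF this]] show ?thesis by simp
  qed
  have limU: "(\<lambda>s. taylor_coeff l (\<lambda>z. apply_bcontfun (U s z) j)) \<longlonglongrightarrow> 0" if "l < n" for l j
  proof -
    have "taylor_coeff l (\<lambda>z. apply_bcontfun (U s z) j) = taylor_coeff l (\<lambda>z. apply_bcontfun (u (r s) z) j)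
        - taylor_coeff l (\<lambda>z. apply_bcontfun (u (r (Suc s)) z) j)" for s
      unfolding U_def by (simp add: taylor_coeff_diff calderonD(1)[OF u(1)])
    then show ?thesis using diff_lim[OF convu[of l j]] that by simp
  qed
  have limV: "(\<lambda>s. taylor_coeff l (\<lambda>z. apply_bcontfun (V s z) j)) \<longlonglongrightarrow> 0" if "l < k" for l j
  proof -
    have "taylor_coeff l (\<lambda>z. apply_bcontfun (V s z) j) = taylor_coeff l (\<lambda>z. apply_bcontfun (v (r s) z) j)
        - taylor_coeff l (\<lambda>z. apply_bcontfun (v (r (Suc s)) z) j)" for s
      unfolding V_def by (simp add: taylor_coeff_diff calderonD(1)[OF v(1)])
    then show ?thesis using diff_lim[OF convv[of l j]] that by simp
  qed
  from jet_le_hump_sum[of n] obtain C1 where C1: "C1 \<ge> 0" and 1: "\<And>m w p K. m \<ge> 1 \<Longrightarrow>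
    (\<forall>i<m. w i \<in> calderon \<and> calderon_norm (w i) \<le> K) \<Longrightarrow> (\<forall>i. p i \<le> p (Suc i)) \<Longrightarrow>
    (\<forall>i<m. jet_le n (\<lambda>z. trunc {..<p i} (w i z)) (1 / m)) \<Longrightarrow>
    (\<forall>i<m. jet_le n (\<lambda>z. trunc {p (Suc i)..} (w i z)) (1 / m)) \<Longrightarrow>
    jet_le n (\<lambda>z. \<Sum>i<m. w i z) ((2 + C1 * K) * (1 + ln (real m)) ^ (n - 1) * sqrt m)"
    by blast
  from jet_le_hump_sum[of k] obtain C2 where C2: "C2 \<ge> 0" and 2: "\<And>m w p K. m \<ge> 1 \<Longrightarrow>
    (\<forall>i<m. w i \<in> calderon \<and> calderon_norm (w i) \<le> K) \<Longrightarrow> (\<forall>i. p i \<le> p (Suc i)) \<Longrightarrow>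
    (\<forall>i<m. jet_le k (\<lambda>z. trunc {..<p i} (w i z)) (1 / m)) \<Longrightarrow>
    (\<forall>i<m. jet_le k (\<lambda>z. trunc {p (Suc i)..} (w i z)) (1 / m)) \<Longrightarrow>
    jet_le k (\<lambda>z. \<Sum>i<m. w i z) ((2 + C2 * K) * (1 + ln (real m)) ^ (k - 1) * sqrt m)"
    by blast
  define C where "C = max (2 + C1 * (2 * K)) (2 + C2 * (2 * K))"
  show thesis
  proof (rule that)
    fix m :: nat assume m: "m \<ge> 1"
    then have \<eta>: "1 / real m > 0" by simp
    have head: "\<forall>\<^sub>F s in sequentially. jet_le n (\<lambda>z. trunc {..<p} (U s z)) (1 / m) \<and>
        jet_le k (\<lambda>z. trunc {..<p} (V s z)) (1 / m)" for p
      by (intro eventually_conj jet_le_head_eventually U V limU limV \<eta>)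
    have tail: "\<forall>\<^sub>F q in sequentially. jet_le n (\<lambda>z. trunc {q..} (U s z)) (1 / m) \<and>
        jet_le k (\<lambda>z. trunc {q..} (V s z)) (1 / m)" for s
      by (intro eventually_conj jet_le_tail U V \<eta>)
    obtain s p :: "nat \<Rightarrow> nat" where s: "\<And>i. s i + 2 \<le> s (Suc i)" and p: "\<And>i. p i \<le> p (Suc i)"
      and H: "\<And>i. jet_le n (\<lambda>z. trunc {..<p i} (U (s i) z)) (1 / m) \<and>
          jet_le k (\<lambda>z. trunc {..<p i} (V (s i) z)) (1 / m)"
      and T: "\<And>i. jet_le n (\<lambda>z. trunc {p (Suc i)..} (U (s i) z)) (1 / m) \<and>
          jet_le k (\<lambda>z. trunc {p (Suc i)..} (V (s i) z)) (1 / m)"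
      using gliding_hump_selection[where
        H = "\<lambda>p s. jet_le n (\<lambda>z. trunc {..<p} (U s z)) (1 / m) \<and> jet_le k (\<lambda>z. trunc {..<p} (V s z)) (1 / m)" and
        T = "\<lambda>q s. jet_le n (\<lambda>z. trunc {q..} (U s z)) (1 / m) \<and> jet_le k (\<lambda>z. trunc {q..} (V s z)) (1 / m)",
        OF head tail] by blast
    define a where "a = (\<lambda>i. r (s i))"
    define b where "b = (\<lambda>i. r (Suc (s i)))"
    have "jet_le n (\<lambda>z. \<Sum>i<m. U (s i) z) ((2 + C1 * (2 * K)) * (1 + ln (real m)) ^ (n - 1) * sqrt m)"
      using H T p U by (intro 1[OF m, of _ _ p]) auto
    moreover have "(2 + C1 * (2 * K)) * (1 + ln (real m)) ^ (n - 1) * sqrt m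
        \<le> C * (1 + ln (real m)) ^ (n - 1) * sqrt m"
      using m by (intro mult_right_mono) (auto simp: C_def)
    ultimately have 3: "jet_le n (\<lambda>z. \<Sum>i<m. u (a i) z - u (b i) z) (C * (1 + ln (real m)) ^ (n - 1) * sqrt m)"
      unfolding U_def a_def b_def by (rule jet_le_mono)
    have "jet_le k (\<lambda>z. \<Sum>i<m. V (s i) z) ((2 + C2 * (2 * K)) * (1 + ln (real m)) ^ (k - 1) * sqrt m)"
      using H T p V by (intro 2[OF m, of _ _ p]) auto
    moreover have "(2 + C2 * (2 * K)) * (1 + ln (real m)) ^ (k - 1) * sqrt m
        \<le> C * (1 + ln (real m)) ^ (k - 1) * sqrt m"
      using m by (intro mult_right_mono) (auto simp: C_def)
    ultimately have "jet_le k (\<lambda>z. \<Sum>i<m. v (a i) z - v (b i) z) (C * (1 + ln (real m)) ^ (k - 1) * sqrt m)"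
      unfolding V_def a_def b_def by (rule jet_le_mono)
    moreover have "a i < b i \<and> b i < a (Suc i)" for i
      unfolding a_def b_def using strict_monoD[OF r] s[of i] by simp
    ultimately show "\<exists>a b :: nat \<Rightarrow> nat. (\<forall>i. a i < b i \<and> b i < a (Suc i)) \<and>
      jet_le n (\<lambda>z. \<Sum>i<m. u (a i) z - u (b i) z) (C * (1 + ln (real m)) ^ (n - 1) * sqrt m) \<and>
      jet_le k (\<lambda>z. \<Sum>i<m. v (a i) z - v (b i) z) (C * (1 + ln (real m)) ^ (k - 1) * sqrt m)"
      using 3 by blast
  qed
qed

section \<open>The lower bound\<close>

text \<open>With \<open>c = ln M\<close>, the factor \<open>exp (c * (z - 1))\<close> compensates
  the at most \<open>M\<close> summands on the left edge and has modulus \<open>1\<close> on the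
  right edge. As the pairing \<open>S\<close> has the jet \<open>M, 0, ..., 0\<close>, the
  coefficient of order \<open>N - 1\<close> of the product sees only the exponential.\<close>

lemma calderon_norm_lower:
  fixes \<sigma> :: "nat \<Rightarrow> complex"
  assumes f: "f \<in> calderon" and A: "finite A" "card A \<le> M" and M: "M \<ge> 1"
    and \<sigma>: "\<And>j. norm (\<sigma> j) \<le> 1"
    and pairing: "(\<Sum>j\<in>A. \<sigma> j * taylor_coeff 0 (\<lambda>z. apply_bcontfun (f z) j)) = of_nat M"
    and higher: "\<And>l j. 0 < l \<Longrightarrow> l < N \<Longrightarrow> taylor_coeff l (\<lambda>z. apply_bcontfun (f z) j) = 0"
    and N: "N \<ge> 1"
  shows "sqrt M * ln (real M) ^ (N - 1) / fact (N - 1) \<le> 4 ^ (N - 1) * calderon_norm f"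
proof -
  note F = calderonD[OF f] calderon_norm_ge[OF f]
  define c where "c = ln (real M)"
  have ec: "exp c = M" using M by (simp add: c_def)
  define S where "S = (\<lambda>z. \<Sum>j\<in>A. \<sigma> j * apply_bcontfun (f z) j)"
  \<comment> \<open>The factor \<open>exp (c * (z - 1))\<close> is split into \<open>P z\<close> and
    the constant \<open>exp (- c / 2)\<close>, so that \<open>P\<close> is centred at
    \<open>1/2\<close> and \<open>taylor_coeff_exp\<close> applies.\<close>
  define P where "P = (\<lambda>z::complex. exp (complex_of_real c * (z - 1/2)))"
  define Q where "Q = (\<lambda>z. complex_of_real (exp (- c / 2)) * S z)"
  define h where "h = (\<lambda>z. P z * Q z)"
  have nh: "norm (h z) = exp (c * (Re z - 1)) * norm (S z)" for z
  proof -
    have "norm (h z) = exp (c * (Re z - 1/2)) * exp (- c / 2) * norm (S z)"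
      by (simp add: h_def P_def Q_def norm_mult)
    also have "exp (c * (Re z - 1/2)) * exp (- c / 2) = exp (c * (Re z - 1))"
      unfolding exp_add[symmetric] by (simp add: algebra_simps)
    finally show ?thesis .
  qed
  have SA: "norm (S z) \<le> (\<Sum>j\<in>A. norm (apply_bcontfun (f z) j))" for z
    unfolding S_def using \<sigma>
    by (intro order_trans[OF norm_sum] sum_mono) (simp add: norm_mult mult_left_le_one_le)
  have Sh: "S holomorphic_on strip" "P holomorphic_on strip" "Q holomorphic_on strip"
    unfolding S_def P_def Q_def by (intro holomorphic_intros F(1))+
  have cc: "continuous_on (closure strip) (\<lambda>z. apply_bcontfun (f z) j)" for j
    by (rule bounded_linear.continuous_on[OF bounded_linear_coord F(2)])
  have "norm (h z) \<le> calderon_norm f" if "z \<in> strip" for z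
  proof (rule three_lines_bound[OF _ _ _ _ _ that])
    show "h holomorphic_on strip" unfolding h_def by (intro holomorphic_intros Sh)
    show "continuous_on (closure strip) h"
      unfolding h_def P_def Q_def S_def by (intro continuous_intros cc)
    obtain B where B: "\<And>z. z \<in> closure strip \<Longrightarrow> norm (f z) \<le> B"
      using F(3) unfolding bounded_iff by auto
    show "bounded (h ` closure strip)"
      unfolding bounded_iff
    proof (intro exI[of _ "1 * (card A * B)"] ballI)
      fix y assume "y \<in> h ` closure strip"
      then obtain z where z: "z \<in> closure strip" "y = h z" by blast
      have "norm (S z) \<le> (\<Sum>j\<in>A. B)"
        by (intro order_trans[OF SA] sum_mono order_trans[OF norm_bounded] B z)
      moreover have "c * (Re z - 1) \<le> 0"
        using z M by (auto simp: closure_strip c_def intro: mult_nonneg_nonpos)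
      ultimately show "norm y \<le> 1 * (card A * B)"
        unfolding z(2) nh by (intro mult_mono) auto
    qed
    fix t :: real
    have "norm (S (\<i> * t)) \<le> (\<Sum>j\<in>A. calderon_norm f)"
      by (intro order_trans[OF SA] sum_mono order_trans[OF norm_bounded] F)
    also have "\<dots> \<le> M * calderon_norm f"
      using A(2) calderon_norm_nonneg[OF f] by (simp add: mult_right_mono)
    finally have "norm (h (\<i> * t)) \<le> exp (- c) * (M * calderon_norm f)"
      unfolding nh by (intro mult_mono) auto
    then show "norm (h (\<i> * t)) \<le> calderon_norm f"
      using M by (simp add: exp_minus ec flip: mult.assoc)
    have "norm (S (1 + \<i> * t)) \<le> norm_1 (f (1 + \<i> * t))"
      using F(4)[of t] unfolding norm_1_def ell_1_def
      by (intro order_trans[OF SA] sum_le_suminf A) auto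
    then show "norm (h (1 + \<i> * t)) \<le> calderon_norm f"
      using F(7)[of t] by (simp add: nh)
  qed
  then have "norm (taylor_coeff (N - 1) h) \<le> 4 ^ (N - 1) * calderon_norm f"
    by (intro norm_taylor_coeff_le) (auto simp: h_def intro!: holomorphic_intros Sh)
  moreover have "taylor_coeff (N - 1) h = of_real (sqrt M * c ^ (N - 1) / fact (N - 1))"
  proof -
    have tS: "taylor_coeff l S = (if l = 0 then of_nat M else 0)" if "l < N" for l
    proof -
      have "taylor_coeff l S = (\<Sum>j\<in>A. \<sigma> j * taylor_coeff l (\<lambda>z. apply_bcontfun (f z) j))"
        unfolding S_def using F(1) by (subst taylor_coeff_sum) (auto intro!: holomorphic_intros sum.cong taylor_coeff_cmult)
      then show ?thesis using pairing higher[OF _ that] by simp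
    qed
    have tQ: "taylor_coeff l Q = (if l = 0 then of_real (exp (- c / 2) * M) else 0)" if "l < N" for l
      unfolding Q_def taylor_coeff_cmult[OF Sh(1)] tS[OF that] by simp
    have "taylor_coeff (N - 1) h = (\<Sum>i\<le>N - 1. taylor_coeff i P * taylor_coeff (N - 1 - i) Q)"
      unfolding h_def by (rule taylor_coeff_mult[OF Sh(2,3)])
    also have "\<dots> = (\<Sum>i\<le>N - 1. if i = N - 1 then taylor_coeff i P * of_real (exp (- c / 2) * M) else 0)"
      using N by (intro sum.cong refl) (auto simp: tQ)
    also have "\<dots> = taylor_coeff (N - 1) P * of_real (exp (- c / 2) * M)" by simp
    also have "exp (- c / 2) * M = sqrt M"
    proof -
      have "exp (- c / 2) = 1 / sqrt M"
        using M by (simp add: c_def exp_minus inverse_eq_divide flip: ln_sqrt)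
      then show ?thesis using M by (simp add: real_div_sqrt)
    qed
    also have "taylor_coeff (N - 1) P = of_real (c ^ (N - 1) / fact (N - 1))"
      unfolding P_def taylor_coeff_exp by simp
    finally show ?thesis by simp
  qed
  moreover have "0 \<le> sqrt M * c ^ (N - 1) / fact (N - 1)"
    using M by (simp add: c_def)
  ultimately show ?thesis by (simp only: norm_of_real abs_of_nonneg c_def)
qed

section \<open>Quotient norms, and images of sums under linear maps\<close>

lemma carr_Z: "carr (Z n) = taylor_tuple n ` calderon"
  and add_Z: "add (Z n) = (\<lambda>x y i. x i + y i)"
  and scale_Z: "scale (Z n) = (\<lambda>c x i. cscale c (x i))"
  and nrm_Z: "nrm (Z n) x = Inf {calderon_norm f | f. f \<in> calderon \<and> taylor_tuple n f = x}"
  by (simp_all add: Z_def)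

lemma nrm_Z_le:
  assumes "f \<in> calderon"
  shows "nrm (Z n) (taylor_tuple n f) \<le> calderon_norm f"
  unfolding nrm_Z using assms
  by (intro cInf_lower bdd_belowI[of _ 0]) (auto intro: calderon_norm_nonneg)

lemma nrm_Z_nonneg: "x \<in> carr (Z n) \<Longrightarrow> 0 \<le> nrm (Z n) x"
  unfolding nrm_Z carr_Z by (intro cInf_greatest) (auto intro: calderon_norm_nonneg)

lemma nrm_Z_lessD:
  assumes "x \<in> carr (Z n)" "nrm (Z n) x < K"
  shows "\<exists>f\<in>calderon. taylor_tuple n f = x \<and> calderon_norm f < K"
  using assms cInf_lessD[of "{calderon_norm f | f. f \<in> calderon \<and> taylor_tuple n f = x}" K]
  unfolding nrm_Z carr_Z by auto

text \<open>Writing the next partial sum through the operations of \<open>Z N\<close> lets a map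
  that respects these operations be evaluated by induction.\<close>

lemma taylor_tuple_const_diff_sum:
  "taylor_tuple N (\<lambda>_. \<Sum>i<Suc m. unit_seq (a i) - unit_seq (b i)) =
    add (Z N) (taylor_tuple N (\<lambda>_. \<Sum>i<m. unit_seq (a i) - unit_seq (b i)))
      (add (Z N) (taylor_tuple N (\<lambda>_. unit_seq (a m))) (scale (Z N) (-1) (taylor_tuple N (\<lambda>_. unit_seq (b m)))))"
proof -
  have "(\<lambda>z. \<Sum>i<m. unit_seq (a i) - unit_seq (b i)) \<in> calderon"
    by (intro calderon_sum calderon_diff calderon_unit_seq)
  then have "taylor_tuple N (\<lambda>_. (\<Sum>i<m. unit_seq (a i) - unit_seq (b i)) + (unit_seq (a m) - unit_seq (b m))) =
      (\<lambda>l. taylor_tuple N (\<lambda>_. \<Sum>i<m. unit_seq (a i) - unit_seq (b i)) l +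
        (taylor_tuple N (\<lambda>_. unit_seq (a m)) l - taylor_tuple N (\<lambda>_. unit_seq (b m)) l))"
    by (simp add: taylor_tuple_add taylor_tuple_diff calderon_diff calderon_unit_seq)
  then show ?thesis
    by (simp add: add_Z scale_Z minus_eq_cscale[of "taylor_tuple N _ _" "taylor_tuple N _ _"])
qed

lemma const_diff_sum_calderon: "(\<lambda>_. \<Sum>i<m. unit_seq (a i) - unit_seq (b i)) \<in> calderon"
  by (intro calderon_sum calderon_diff calderon_unit_seq)

lemma linear_image_const_diff_sum:
  fixes a b :: "nat \<Rightarrow> nat" and m :: nat
  assumes add: "\<And>x y. x \<in> carr (Z N) \<Longrightarrow> y \<in> carr (Z N) \<Longrightarrow>
      T (add (Z N) x y) = add (direct_sum (Z n) (Z k)) (T x) (T y)"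
    and scale: "\<And>c x. x \<in> carr (Z N) \<Longrightarrow> T (scale (Z N) c x) = scale (direct_sum (Z n) (Z k)) c (T x)"
    and u: "\<And>i. u i \<in> calderon" and v: "\<And>i. v i \<in> calderon"
    and Tuv: "\<And>i. T (taylor_tuple N (\<lambda>_. unit_seq i)) = (taylor_tuple n (u i), taylor_tuple k (v i))"
  shows "T (taylor_tuple N (\<lambda>_. \<Sum>i<m. unit_seq (a i) - unit_seq (b i))) =
    (taylor_tuple n (\<lambda>z. \<Sum>i<m. u (a i) z - u (b i) z),
     taylor_tuple k (\<lambda>z. \<Sum>i<m. v (a i) z - v (b i) z))"
proof (induction m)
  case 0
  have z: "taylor_tuple l (\<lambda>_. 0) = (\<lambda>_. 0)" for l
    using taylor_tuple_sum[of "{}" "\<lambda>_ _. 0" l] by simp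
  \<comment> \<open>The map is only known to respect \<open>add\<close> and \<open>scale\<close>, so
    its value on the empty sum is found by scaling a unit vector with \<open>0\<close>.\<close>
  have "scale (Z N) 0 (taylor_tuple N (\<lambda>_. unit_seq 0)) = (\<lambda>_. 0)"
    unfolding scale_Z by (intro ext bcontfun_eqI) simp
  then have "T (\<lambda>_. 0) = scale (direct_sum (Z n) (Z k)) 0 (T (taylor_tuple N (\<lambda>_. unit_seq 0)))"
    using scale[of "taylor_tuple N (\<lambda>_. unit_seq 0)" 0] calderon_unit_seq by (simp add: carr_Z)
  also have "\<dots> = (\<lambda>_. 0, \<lambda>_. 0)"
    unfolding direct_sum_def scale_Z by (auto intro!: ext bcontfun_eqI)
  finally show ?case by (simp add: z)
next
  case (Suc m)
  \<comment> \<open>The rules for \<open>T\<close> require arguments in the carrier, so each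
    intermediate vector is exhibited as the tuple of a function in \<open>calderon\<close>.\<close>
  have s: "scale (Z N) (-1) (taylor_tuple N (\<lambda>_. unit_seq i)) \<in> carr (Z N)" for i
  proof -
    have "(\<lambda>_. - unit_seq i) \<in> calderon"
      using calderon_diff[OF calderon_const[OF ell_1_0] calderon_unit_seq(1)] by simp
    moreover have "scale (Z N) (-1) (taylor_tuple N (\<lambda>_. unit_seq i)) = taylor_tuple N (\<lambda>_. - unit_seq i)"
      using calderon_unit_seq(1) calculation unfolding scale_Z
      by (intro ext bcontfun_eqI) (simp add: taylor_tuple_coord taylor_coeff_const)
    ultimately show ?thesis by (simp add: carr_Z)
  qed
  have e: "taylor_tuple N (\<lambda>_. unit_seq i) \<in> carr (Z N)" for i
    using calderon_unit_seq by (simp add: carr_Z)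
  have D: "taylor_tuple N (\<lambda>_. \<Sum>i<m. unit_seq (a i) - unit_seq (b i)) \<in> carr (Z N)"
    unfolding carr_Z by (intro imageI const_diff_sum_calderon)
  have es: "add (Z N) (taylor_tuple N (\<lambda>_. unit_seq i)) (scale (Z N) (-1) (taylor_tuple N (\<lambda>_. unit_seq j))) \<in> carr (Z N)" for i j
  proof -
    have "add (Z N) (taylor_tuple N (\<lambda>_. unit_seq i)) (scale (Z N) (-1) (taylor_tuple N (\<lambda>_. unit_seq j)))
      = taylor_tuple N (\<lambda>_. unit_seq i - unit_seq j)"
      using calderon_unit_seq
      by (simp add: add_Z scale_Z taylor_tuple_diff minus_eq_cscale[of "taylor_tuple N _ _" "taylor_tuple N _ _"])
    then show ?thesis using calderon_diff(1)[OF calderon_unit_seq(1) calderon_unit_seq(1)] by (simp add: carr_Z)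
  qed
  have uc: "(\<lambda>z. \<Sum>i<m. u (a i) z - u (b i) z) \<in> calderon" "(\<lambda>z. \<Sum>i<m. v (a i) z - v (b i) z) \<in> calderon"
    using u v by (auto intro!: calderon_sum calderon_diff)
  show ?case
    unfolding taylor_tuple_const_diff_sum add[OF D es] add[OF e s] scale[OF e] Suc.IH Tuv
    by (simp add: direct_sum_def add_Z scale_Z taylor_tuple_add taylor_tuple_diff uc u v calderon_diff
      minus_eq_cscale[of "taylor_tuple _ _ _" "taylor_tuple _ _ _"])
qed

text \<open>The signs are \<open>1\<close> on the indices \<open>a i\<close> and \<open>- 1\<close>
  elsewhere. Interlacing makes the ranges of \<open>a\<close> and \<open>b\<close> disjoint, so each
  difference contributes \<open>2\<close> to the pairing and \<open>calderon_norm_lower\<close>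
  applies with \<open>M = 2 * m\<close>.\<close>

lemma const_diff_sum_lower:
  fixes a b :: "nat \<Rightarrow> nat"
  assumes ab: "\<And>i. a i < b i \<and> b i < a (Suc i)" and m: "m \<ge> 1" and N: "N \<ge> 1"
    and f: "f \<in> calderon" "taylor_tuple N f = taylor_tuple N (\<lambda>_. \<Sum>i<m. unit_seq (a i) - unit_seq (b i))"
  shows "sqrt (2 * m) * ln (2 * real m) ^ (N - 1) / fact (N - 1) \<le> 4 ^ (N - 1) * calderon_norm f"
proof -
  define \<sigma> where "\<sigma> = (\<lambda>j. if j \<in> range a then 1 else - 1 :: complex)"
  define A where "A = a ` {..<m} \<union> b ` {..<m}"
  have "strict_mono a"
    using ab by (intro strict_mono_Suc_iff[THEN iffD2]) (meson less_trans)
  then have "b i \<noteq> a j" for i j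
    using ab[of i] strict_mono_less[of a i j] strict_mono_less[of a j "Suc i"]
    by (metis less_antisym not_less_eq order.asym)
  then have \<sigma>ab: "\<sigma> (a i) = 1" "\<sigma> (b i) = - 1" for i
    by (auto simp: \<sigma>_def)
  let ?s = "\<Sum>i<m. unit_seq (a i) - unit_seq (b i)"
  have tcf: "taylor_coeff l (\<lambda>z. apply_bcontfun (f z) j) = (if l = 0 then apply_bcontfun ?s j else 0)" if "l < N" for l j
    using f(2)[unfolded taylor_tuple_eq_iff[OF f(1) const_diff_sum_calderon]] that by (simp add: taylor_coeff_const)
  have "card A \<le> m + m"
    unfolding A_def by (intro order_trans[OF card_Un_le] add_mono order_trans[OF card_image_le]) auto
  have "sqrt (2 * m) * ln (real (2 * m)) ^ (N - 1) / fact (N - 1) \<le> 4 ^ (N - 1) * calderon_norm f"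
  proof (rule calderon_norm_lower[OF f(1), where A = A and \<sigma> = \<sigma>])
    show "finite A" by (simp add: A_def)
    show "card A \<le> 2 * m" using \<open>card A \<le> m + m\<close> by simp
    show "norm (\<sigma> j) \<le> 1" for j by (simp add: \<sigma>_def)
    have "(\<Sum>j\<in>A. \<sigma> j * taylor_coeff 0 (\<lambda>z. apply_bcontfun (f z) j))
        = (\<Sum>j\<in>A. \<Sum>i<m. \<sigma> j * (apply_bcontfun (unit_seq (a i)) j - apply_bcontfun (unit_seq (b i)) j))"
      using N by (simp add: tcf apply_bcontfun_sum sum_distrib_left)
    also have "\<dots> = (\<Sum>i<m. \<Sum>j\<in>A. \<sigma> j * (apply_bcontfun (unit_seq (a i)) j - apply_bcontfun (unit_seq (b i)) j))"
      by (rule sum.swap)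
    also have "\<dots> = (\<Sum>i<m. 2)"
    proof (rule sum.cong)
      fix i assume i: "i \<in> {..<m}"
      have "(\<Sum>j\<in>A. \<sigma> j * (apply_bcontfun (unit_seq (a i)) j - apply_bcontfun (unit_seq (b i)) j))
          = (\<Sum>j\<in>A. (if j = a i then \<sigma> (a i) else 0) - (if j = b i then \<sigma> (b i) else 0))"
        using ab[of i] by (intro sum.cong) auto
      also have "\<dots> = 2"
        using i by (simp add: sum_subtractf \<sigma>ab A_def)
      finally show "(\<Sum>j\<in>A. \<sigma> j * (apply_bcontfun (unit_seq (a i)) j - apply_bcontfun (unit_seq (b i)) j)) = 2" .
    qed simp
    finally show "(\<Sum>j\<in>A. \<sigma> j * taylor_coeff 0 (\<lambda>z. apply_bcontfun (f z) j)) = of_nat (2 * m)"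
      by simp
  qed (use m N tcf in auto)
  then show ?thesis by simp
qed

text \<open>Up to constants both sides carry the same \<open>sqrt m\<close>, but the right side has
  one more power of the logarithm, so a large \<open>ln m\<close> beats any
  \<open>B\<close>.\<close>

lemma log_growth_contradiction:
  fixes B :: real
  assumes "N \<ge> 2"
  obtains m :: nat where "m \<ge> 1"
    "B * ((1 + ln (real m)) ^ (N - 2) * sqrt m) < sqrt (2 * m) * ln (2 * real m) ^ (N - 1) / fact (N - 1)"
proof -
  \<comment> \<open>\<open>D\<close> collects the losses: \<open>2 ^ (N - 1)\<close> from passing
    from \<open>ln (2 * m)\<close> to half of \<open>1 + ln m\<close>, the factorial, and
    \<open>\<bar>B\<bar>\<close>.\<close>
  define D where "D = 2 ^ (N - 1) * fact (N - 1) * \<bar>B\<bar>"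
  obtain m :: nat where m: "exp D < real m" using reals_Archimedean2 by blast
  have "D \<ge> 0" by (simp add: D_def)
  then have m1: "m \<ge> 1" using m exp_ge_add_one_self[of D] by linarith
  have "ln (exp D) < ln (real m)" using m m1 by (subst ln_less_cancel_iff) auto
  then have "D < ln m" by simp
  define L where "L = 1 + ln (real m)"
  have L: "L \<ge> 1" "L > D" using m1 \<open>D < ln m\<close> by (auto simp: L_def)
  have "ln (2 * real m) = ln 2 + ln m" using m1 by (simp add: ln_mult)
  moreover have "0 \<le> ln (real m)" using m1 by simp
  \<comment> \<open>Used with \<open>l = ln 2\<close> and \<open>x = ln m\<close>, where
    \<open>ln 2\<close> pays for the \<open>1/2\<close> on the left.\<close>
  moreover have "(1 + x) / 2 \<le> y" if "y = l + x" "0 \<le> x" "2 / 3 \<le> l" for x y l :: real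
    using that by simp
  ultimately have half: "L / 2 \<le> ln (2 * real m)"
    unfolding L_def using ln2_ge_two_thirds by blast
  have N: "N - 1 = Suc (N - 2)" using assms by simp
  have sq: "sqrt m > 0" using m1 by simp
  have "B * (L ^ (N - 2) * sqrt m) \<le> \<bar>B\<bar> * (L ^ (N - 2) * sqrt m)"
    using L by (intro mult_right_mono) auto
  also have "\<dots> = (D / (2 ^ (N - 1) * fact (N - 1))) * (L ^ (N - 2) * sqrt m)"
    by (simp add: D_def)
  also have "\<dots> < (L / (2 ^ (N - 1) * fact (N - 1))) * (L ^ (N - 2) * sqrt m)"
    using L sq by (intro mult_strict_right_mono divide_strict_right_mono) auto
  also have "\<dots> = sqrt m * (L / 2) ^ (N - 1) / fact (N - 1)"
    unfolding N by (simp add: power_divide)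
  also have "\<dots> \<le> sqrt (2 * m) * ln (2 * real m) ^ (N - 1) / fact (N - 1)"
    using L half by (intro divide_right_mono mult_mono power_mono) auto
  finally show thesis using that m1 unfolding L_def by blast
qed

theorem corollary4p5:
  fixes n k :: nat
  assumes "n \<ge> 1" and "k \<ge> 1"
  shows "\<not> isomorphic (Z (n + k)) (direct_sum (Z n) (Z k))"
proof
  define N where "N = n + k"
  let ?Y = "direct_sum (Z n) (Z k)"
  assume "isomorphic (Z (n + k)) ?Y"
  then obtain T C1 C2 where bij: "bij_betw T (carr (Z N)) (carr ?Y)"
    and add: "\<And>x y. x \<in> carr (Z N) \<Longrightarrow> y \<in> carr (Z N) \<Longrightarrow> T (add (Z N) x y) = add ?Y (T x) (T y)"
    and scale: "\<And>c x. x \<in> carr (Z N) \<Longrightarrow> T (scale (Z N) c x) = scale ?Y c (T x)"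
    and C1: "\<And>x. x \<in> carr (Z N) \<Longrightarrow> nrm ?Y (T x) \<le> C1 * nrm (Z N) x"
    and C2: "\<And>x. x \<in> carr (Z N) \<Longrightarrow> nrm (Z N) x \<le> C2 * nrm ?Y (T x)"
    unfolding isomorphic_def N_def by blast
  have carrY: "carr ?Y = carr (Z n) \<times> carr (Z k)"
    and nrmY: "nrm ?Y p = nrm (Z n) (fst p) + nrm (Z k) (snd p)" for p
    by (simp_all add: direct_sum_def)
  let ?e = "\<lambda>i. taylor_tuple N (\<lambda>_. unit_seq i)"
  have e: "?e i \<in> carr (Z N)" for i
    using calderon_unit_seq by (simp add: carr_Z)
  \<comment> \<open>The absolute value allows for a negative \<open>C1\<close>; the summand
    \<open>1\<close> makes the norm bounds strict, so that \<open>nrm_Z_lessD\<close> supplies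
    representatives.\<close>
  define K where "K = \<bar>C1\<bar> + 1"
  have "\<exists>f g. f \<in> calderon \<and> g \<in> calderon \<and> calderon_norm f \<le> K \<and> calderon_norm g \<le> K \<and>
      T (?e i) = (taylor_tuple n f, taylor_tuple k g)" for i
  proof -
    have TY: "fst (T (?e i)) \<in> carr (Z n)" "snd (T (?e i)) \<in> carr (Z k)"
      using bij_betwE[OF bij] e[of i] carrY by auto
    have "nrm (Z N) (?e i) \<le> 1"
      using nrm_Z_le[OF calderon_unit_seq(1)] calderon_unit_seq(2) order_trans by blast
    then have "C1 * nrm (Z N) (?e i) \<le> \<bar>C1\<bar> * 1"
      using nrm_Z_nonneg[OF e] by (intro mult_mono) auto
    then have "nrm (Z n) (fst (T (?e i))) + nrm (Z k) (snd (T (?e i))) < K"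
      using C1[OF e[of i]] by (simp add: nrmY K_def)
    then have "nrm (Z n) (fst (T (?e i))) < K" "nrm (Z k) (snd (T (?e i))) < K"
      using nrm_Z_nonneg[OF TY(1)] nrm_Z_nonneg[OF TY(2)] by linarith+
    from nrm_Z_lessD[OF TY(1) this(1)] nrm_Z_lessD[OF TY(2) this(2)] obtain f g
      where "f \<in> calderon" "taylor_tuple n f = fst (T (?e i))" "calderon_norm f < K"
        "g \<in> calderon" "taylor_tuple k g = snd (T (?e i))" "calderon_norm g < K"
      by blast
    then show ?thesis by (intro exI[of _ f] exI[of _ g]) auto
  qed
  then have "\<forall>i. \<exists>f g. f \<in> calderon \<and> g \<in> calderon \<and> calderon_norm f \<le> K \<and> calderon_norm g \<le> K \<and>
      T (?e i) = (taylor_tuple n f, taylor_tuple k g)"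
    by blast
  then obtain u v where uv: "\<And>i. u i \<in> calderon" "\<And>i. v i \<in> calderon"
      "\<And>i. calderon_norm (u i) \<le> K" "\<And>i. calderon_norm (v i) \<le> K"
    and Tuv: "\<And>i. T (?e i) = (taylor_tuple n (u i), taylor_tuple k (v i))"
    unfolding choice_iff by blast
  obtain C where C: "\<And>m. m \<ge> 1 \<Longrightarrow> \<exists>a b :: nat \<Rightarrow> nat. (\<forall>i. a i < b i \<and> b i < a (Suc i)) \<and>
    jet_le n (\<lambda>z. \<Sum>i<m. u (a i) z - u (b i) z) (C * (1 + ln (real m)) ^ (n - 1) * sqrt m) \<and>
    jet_le k (\<lambda>z. \<Sum>i<m. v (a i) z - v (b i) z) (C * (1 + ln (real m)) ^ (k - 1) * sqrt m)"
    using sums_of_differences_upper[where u = u and v = v and K = K and n = n and k = k, OF uv(1,3,2,4)]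
    by blast
  \<comment> \<open>\<open>4 ^ (N - 1)\<close> is the Cauchy factor of the lower bound,
    \<open>2\<close> counts the components of the direct sum, and the summand \<open>1\<close> makes
    the bound on the norm strict, again to obtain a representative. As \<open>B\<close> does not
    depend on \<open>m\<close>, a contradictory \<open>m\<close> can be fixed before the indices are
    drawn.\<close>
  define B where "B = 4 ^ (N - 1) * (\<bar>C2\<bar> * (2 * \<bar>C\<bar>) + 1)"
  have N: "N \<ge> 2" "N \<ge> 1" using assms by (auto simp: N_def)
  obtain m :: nat where m: "m \<ge> 1" and contra:
    "B * ((1 + ln (real m)) ^ (N - 2) * sqrt m) < sqrt (2 * m) * ln (2 * real m) ^ (N - 1) / fact (N - 1)"
    using log_growth_contradiction[OF N(1)] by blast
  define E where "E = (1 + ln (real m)) ^ (N - 2) * sqrt m"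
  have E: "1 * 1 \<le> E"
    unfolding E_def using m by (intro mult_mono) (auto intro!: one_le_power)
  \<comment> \<open>Since \<open>n\<close> and \<open>k\<close> are positive, both
    \<open>n - 1\<close> and \<open>k - 1\<close> are at most \<open>N - 2\<close>. This missing
    power of the logarithm produces the contradiction.\<close>
  have le_E: "C * (1 + ln (real m)) ^ r * sqrt m \<le> \<bar>C\<bar> * E" if "r \<le> N - 2" for r
    unfolding E_def mult.assoc using m that by (intro mult_mono power_increasing) auto
  obtain a b :: "nat \<Rightarrow> nat" where ab: "\<And>i. a i < b i \<and> b i < a (Suc i)"
    and gu: "jet_le n (\<lambda>z. \<Sum>i<m. u (a i) z - u (b i) z) (C * (1 + ln (real m)) ^ (n - 1) * sqrt m)"
    and gv: "jet_le k (\<lambda>z. \<Sum>i<m. v (a i) z - v (b i) z) (C * (1 + ln (real m)) ^ (k - 1) * sqrt m)"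
    using C[OF m] by blast
  let ?d = "taylor_tuple N (\<lambda>_. \<Sum>i<m. unit_seq (a i) - unit_seq (b i))"
  have d: "?d \<in> carr (Z N)"
    unfolding carr_Z by (intro imageI const_diff_sum_calderon)
  have jet_nrm: "nrm (Z r) (taylor_tuple r f) \<le> M" if "jet_le r f M" for r f M
    using that nrm_Z_le unfolding jet_le_def by (metis order_trans)
  have Td: "T ?d = (taylor_tuple n (\<lambda>z. \<Sum>i<m. u (a i) z - u (b i) z),
      taylor_tuple k (\<lambda>z. \<Sum>i<m. v (a i) z - v (b i) z))"
    by (rule linear_image_const_diff_sum[OF add scale uv(1,2) Tuv])
  have "nrm ?Y (T ?d) \<le> \<bar>C\<bar> * E + \<bar>C\<bar> * E"
    unfolding nrmY Td fst_conv snd_conv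
    using assms by (intro add_mono order_trans[OF jet_nrm[OF gu]] order_trans[OF jet_nrm[OF gv]] le_E) (auto simp: N_def)
  moreover have "0 \<le> nrm ?Y (T ?d)"
    using bij_betwE[OF bij] d carrY nrm_Z_nonneg unfolding nrmY by (intro add_nonneg_nonneg) auto
  ultimately have "C2 * nrm ?Y (T ?d) \<le> \<bar>C2\<bar> * (\<bar>C\<bar> * E + \<bar>C\<bar> * E)"
    by (intro mult_mono) auto
  then have "nrm (Z N) ?d \<le> \<bar>C2\<bar> * (2 * \<bar>C\<bar>) * E"
    using C2[OF d] by (simp add: algebra_simps)
  then have "nrm (Z N) ?d < (\<bar>C2\<bar> * (2 * \<bar>C\<bar>) + 1) * E"
    using E by (simp add: algebra_simps)
  then obtain f where f: "f \<in> calderon" "taylor_tuple N f = ?d"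
    "calderon_norm f < (\<bar>C2\<bar> * (2 * \<bar>C\<bar>) + 1) * E"
    using nrm_Z_lessD[OF d] by blast
  have "sqrt (2 * m) * ln (2 * real m) ^ (N - 1) / fact (N - 1) \<le> 4 ^ (N - 1) * calderon_norm f"
    by (rule const_diff_sum_lower[OF ab m N(2) f(1,2)])
  also have "\<dots> \<le> 4 ^ (N - 1) * ((\<bar>C2\<bar> * (2 * \<bar>C\<bar>) + 1) * E)"
    using f(3) by (intro mult_left_mono) auto
  also have "\<dots> = B * E" by (simp add: B_def)
  finally show False using contra by (simp add: E_def)
qed

end
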